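(* Let $\delta_n\to0^+$ as $n\to\infty$. Then $E_{\delta_n}$ $\Gamma$-converges to $F$ in the weak topology of $A$, i.e.: (i) for every $\xi^*\in A$ and every sequence $\{\xi_n\}\subset A$ converging weakly to $\xi^*$ in $A$, $\liminf_{n\to\infty}E_{\delta_n}[\xi_n]\ge F[\xi^*]$; (ii) for every $\xi^*\in A$ there is a sequence $\{\xi_n\}\subset A$ converging weakly to $\xi^*$ in $A$ with $\limsup_{n\to\infty}E_{\delta_n}[\xi_n]\le F[\xi^*]$.
   Context: Let $w:\mathbb{R}\to\mathbb{R}$ be a function with continuous third derivative, periodic with period $1$, with $w(z)=0$ for all $z\in\mathbb{Z}$, $w(\xi)>0$ for $\xi\notin\mathbb{Z}$, $w''(z)>0$ for all $z\in\mathbb{Z}$, and $w(1-\xi)=w(\xi)$ for all $\xi$. Let $\bar v:\mathbb{R}\to\mathbb{R}$ be continuously differentiable and strictly increasing with $\bar v(x)\to0$ as $x\to-\infty$, $\bar v(x)\to1$ as $x\to\infty$, $1-\bar v\in L^1([0,\infty))\cap L^2([0,\infty))$, $\bar v\in L^1((-\infty,0])\cap L^2((-\infty,0])$, $\bar v'\in L^1(\mathbb{R})\cap L^2(\mathbb{R})$. Let $A=\{\xi:\xi-\bar v\in H^1(\mathbb{R})\}$; a sequence $\xi_n$ converges weakly to $\xi$ in $A$ if $\xi_n-\bar v\rightharpoonup\xi-\bar v$ weakly in $H^1(\mathbb{R})$. For $\delta>0$, $A_\delta$ is the set of continuous $\xi\in A$ that are affine on each interval $[(i-1)\delta,i\delta]$,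 $i\in\mathbb{Z}$. Define $E_\delta:A\to[0,\infty]$ by $E_\delta[\xi]=\int_{-\infty}^\infty\xi'(x)^2\,dx+\int_{-\infty}^\infty w(\xi(x))\,dx$ if $\xi\in A_\delta$ and $E_\delta[\xi]=\infty$ otherwise, and $F:A\to[0,\infty]$ by $F[\xi]=\int_{-\infty}^\infty\xi'(x)^2\,dx+\int_{-\infty}^\infty w(\xi(x))\,dx$. *)

theory Defs
  imports "HOL-Analysis.Analysis"
begin

definition test_fun :: "(real \<Rightarrow> real) \<Rightarrow> bool" where
  "test_fun \<phi> \<longleftrightarrow> (\<forall>k x. ((deriv ^^ k) \<phi>) differentiable (at x))
                   \<and> (\<exists>R. \<forall>x. \<bar>x\<bar> > R \<longrightarrow> \<phi> x = 0)"

definition is_weak_deriv :: "(real \<Rightarrow> real) \<Rightarrow> (real \<Rightarrow> real) \<Rightarrow> bool" where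
  "is_weak_deriv f g \<longleftrightarrow> g \<in> borel_measurable lborel \<and>
     (\<forall>\<phi>. test_fun \<phi> \<longrightarrow>
        integrable lborel (\<lambda>x. f x * deriv \<phi> x) \<and> integrable lborel (\<lambda>x. g x * \<phi> x) \<and>
        (\<integral>x. f x * deriv \<phi> x \<partial>lborel) = - (\<integral>x. g x * \<phi> x \<partial>lborel))"

definition wderiv :: "(real \<Rightarrow> real) \<Rightarrow> (real \<Rightarrow> real)" where
  "wderiv f = (SOME g. is_weak_deriv f g)"

definition L2 :: "(real \<Rightarrow> real) \<Rightarrow> bool" where
  "L2 f \<longleftrightarrow> f \<in> borel_measurable lborel \<and> integrable lborel (\<lambda>x. (f x)\<^sup>2)"

definition H1 :: "(real \<Rightarrow> real) \<Rightarrow> bool" where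
  "H1 f \<longleftrightarrow> L2 f \<and> (\<exists>g. is_weak_deriv f g \<and> L2 g)"

definition H1_inner :: "(real \<Rightarrow> real) \<Rightarrow> (real \<Rightarrow> real) \<Rightarrow> real" where
  "H1_inner f g = (\<integral>x. f x * g x \<partial>lborel) + (\<integral>x. wderiv f x * wderiv g x \<partial>lborel)"

definition adm :: "(real \<Rightarrow> real) \<Rightarrow> (real \<Rightarrow> real) set" where
  "adm vbar = {\<xi>. H1 (\<lambda>x. \<xi> x - vbar x)}"

definition weak_conv_A :: "(real \<Rightarrow> real) \<Rightarrow> (nat \<Rightarrow> real \<Rightarrow> real) \<Rightarrow> (real \<Rightarrow> real) \<Rightarrow> bool" where
  "weak_conv_A vbar xs \<xi> \<longleftrightarrow>
     (\<forall>g. H1 g \<longrightarrow> (\<lambda>n. H1_inner (\<lambda>x. xs n x - vbar x) g) \<longlonglongrightarrow> H1_inner (\<lambda>x. \<xi> x - vbar x) g)"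

definition adm_delta :: "(real \<Rightarrow> real) \<Rightarrow> real \<Rightarrow> (real \<Rightarrow> real) set" where
  "adm_delta vbar \<delta> = {\<xi> \<in> adm vbar. continuous_on UNIV \<xi> \<and>
     (\<forall>i::int. \<exists>a b. \<forall>x \<in> {(of_int i - 1) * \<delta> .. of_int i * \<delta>}. \<xi> x = a * x + b)}"

definition Fen :: "(real \<Rightarrow> real) \<Rightarrow> (real \<Rightarrow> real) \<Rightarrow> ennreal" where
  "Fen w \<xi> = (\<integral>\<^sup>+x. ennreal ((wderiv \<xi> x)\<^sup>2) \<partial>lborel) + (\<integral>\<^sup>+x. ennreal (w (\<xi> x)) \<partial>lborel)"

definition Eden :: "(real \<Rightarrow> real) \<Rightarrow> (real \<Rightarrow> real) \<Rightarrow> real \<Rightarrow> (real \<Rightarrow> real) \<Rightarrow> ennreal" where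
  "Eden w vbar \<delta> \<xi> = (if \<xi> \<in> adm_delta vbar \<delta> then Fen w \<xi> else \<infinity>)"

end

theory Submission
  imports Defs "HOL-Real_Asymp.Real_Asymp" "HOL-Computational_Algebra.Polynomial"
begin

text \<open>
  A function of class $H^1$ agrees almost everywhere with a primitive of its weak derivative, and
  evaluating this primitive at $x$ is the $H^1$ inner product with $e^{-|x-y|}/2$. So weak
  convergence in $A$ gives pointwise convergence of the continuous representatives, and the lower
  bound follows from Fatou's lemma for the potential term and from weak lower semicontinuity of the
  $L^2$ norm for the derivatives, whose integrals over intervals are differences of point values.

  A recovery sequence is given by the affine interpolants $u$ of the continuous representative $X$
  at the points of the grid $\delta\mathbb{Z}$. On each cell both the slope of $u$ and the
  error $u - X$ are controlled by the integral of $(X')^2$ over that cell; averaging over cells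
  yields $\int (u')^2 \le \int (X')^2$ and $\int (u - X)^2 \le 4 \delta^2 \int (X')^2$. As $w$ vanishes
  to second order on the integers, $\int w(u) - \int w(X)$ is at most of order $\delta$.
\<close>

section \<open>Smooth bump functions\<close>

text \<open>Admissible functions are known only almost everywhere and \<open>wderiv\<close> is an
  arbitrary choice among weak derivatives, so every energy is first rewritten through a pair
  \<open>antideriv X g\<close> with \<open>X\<close> continuous. A weakly convergent sequence is
  never shown to be bounded in H^1: pointwise convergence needs a single test function per point,
  and the semicontinuity argument takes its bound from a subsequence on which the Dirichlet integral
  is assumed too small. In the recovery step the obstacle is the infinite line: \<open>u - X\<close>
  is controlled only in L^2, so a Lipschitz bound on \<open>w\<close> says nothing about the
  integral of \<open>w(u) - w(X)\<close>. The second order zeros improve that bound to a multiple of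
  \<open>|u - X|\<close> times \<open>|X - m| + |u - X|\<close> for any integer \<open>m\<close>.
  With \<open>m\<close> the step function from 0 to 1, \<open>X - m\<close> lies in L^2 because
  \<open>vbar\<close> approaches its limits in L^2, and Cauchy-Schwarz yields a quantity of order
  \<delta>.\<close>

definition smooth :: "(real \<Rightarrow> real) \<Rightarrow> bool" where
  "smooth f \<longleftrightarrow> (\<forall>k x. ((deriv ^^ k) f) differentiable (at x))"

text \<open>All iterated derivatives stay in \<open>S\<close>, so smoothness reduces to exhibiting a
  class of functions closed under differentiation. Each smoothness proof below consists in finding
  such a class.\<close>

lemma smoothI_closed:
  assumes closed: "\<And>f. f \<in> S \<Longrightarrow> \<exists>f'\<in>S. \<forall>x. (f has_real_derivative f' x) (at x)" and "f \<in> S"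
  shows "smooth f"
proof -
  have "deriv g \<in> S" if "g \<in> S" for g
    using closed[OF that] DERIV_imp_deriv ext by metis
  then have "(deriv ^^ k) f \<in> S" for k
    by (induction k) (auto simp: \<open>f \<in> S\<close>)
  then show ?thesis
    unfolding smooth_def by (meson closed real_differentiable_def)
qed

lemma smooth_has_deriv: "smooth f \<Longrightarrow> (f has_real_derivative deriv f x) (at x)"
  unfolding smooth_def
  by (metis DERIV_deriv_iff_real_differentiable funpow_0)

lemma smooth_deriv: "smooth f \<Longrightarrow> smooth (deriv f)"
  unfolding smooth_def by (metis funpow_Suc_right comp_apply)

lemma smooth_antideriv:
  assumes "smooth f" "\<And>x. (F has_real_derivative f x) (at x)"
  shows "smooth F"
proof -
  have "deriv F = f" using assms(2) DERIV_imp_deriv ext by metis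
  then have "((deriv ^^ k) F) differentiable (at x)" for k x
    using assms by (cases k) (auto simp: smooth_def funpow_Suc_right real_differentiable_def simp del: funpow.simps)
  then show ?thesis by (simp add: smooth_def)
qed

text \<open>By the Leibniz rule the derivative of a product is a sum of two products; closing under
  sums makes the class stable under differentiation.\<close>

inductive_set product_sums :: "(real \<Rightarrow> real) set" where
  base: "smooth f \<Longrightarrow> smooth g \<Longrightarrow> (\<lambda>x. f x * g x) \<in> product_sums"
| add: "f \<in> product_sums \<Longrightarrow> g \<in> product_sums \<Longrightarrow> (\<lambda>x. f x + g x) \<in> product_sums"

lemma product_sums_smooth: "f \<in> product_sums \<Longrightarrow> smooth f"
proof (rule smoothI_closed[of product_sums])
  fix f assume "f \<in> product_sums"
  then show "\<exists>f'\<in>product_sums. \<forall>x. (f has_real_derivative f' x) (at x)"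
  proof induction
    case (base f g)
    have "((\<lambda>x. f x * g x) has_real_derivative deriv f x * g x + f x * deriv g x) (at x)" for x
      by (auto intro!: derivative_eq_intros smooth_has_deriv base)
    then show ?case
      by (intro bexI[of _ "\<lambda>x. deriv f x * g x + f x * deriv g x"])
        (auto intro!: product_sums.intros smooth_deriv base)
  next
    case (add f g)
    then obtain f' g' where "f' \<in> product_sums" "\<forall>x. (f has_real_derivative f' x) (at x)"
      "g' \<in> product_sums" "\<forall>x. (g has_real_derivative g' x) (at x)" by auto
    then show ?case
      by (intro bexI[of _ "\<lambda>x. f' x + g' x"]) (auto intro!: product_sums.intros derivative_eq_intros)
  qed
qed

lemma smooth_const: "smooth (\<lambda>x. c)"
  by (rule smoothI_closed[of "range (\<lambda>c x. c)"]) (auto intro!: derivative_eq_intros)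

lemma smooth_mult: "smooth f \<Longrightarrow> smooth g \<Longrightarrow> smooth (\<lambda>x. f x * g x)"
  by (rule product_sums_smooth[OF product_sums.base])

lemma smooth_add:
  assumes "smooth f" "smooth g" shows "smooth (\<lambda>x. f x + g x)"
proof -
  \<comment> \<open>The constant factor 1 turns both summands into products, so sums need no class
    of their own.\<close>
  have "(\<lambda>x. f x * 1 + g x * 1) \<in> product_sums"
    by (rule product_sums.add; rule product_sums.base; rule smooth_const assms)
  from product_sums_smooth[OF this] show ?thesis by simp
qed

text \<open>The chain rule only adds a factor \<open>c\<close>, which the free scalar
  \<open>a\<close> of the class absorbs.\<close>

lemma smooth_affine:
  assumes "smooth f" shows "smooth (\<lambda>x. f (c * x + d))"
proof (rule smoothI_closed[of "{\<lambda>x. a * f (c * x + d) | a f. smooth f}"])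
  fix h assume "h \<in> {\<lambda>x. a * f (c * x + d) | a f. smooth f}"
  then obtain a f where h: "h = (\<lambda>x. a * f (c * x + d))" "smooth f" by auto
  have "(h has_real_derivative (a * c) * deriv f (c * x + d)) (at x)" for x
    unfolding h by (auto intro!: derivative_eq_intros DERIV_chain'[OF _ smooth_has_deriv[OF h(2)]])
  then show "\<exists>f'\<in>{\<lambda>x. a * f (c * x + d) | a f. smooth f}. \<forall>x. (h has_real_derivative f' x) (at x)"
    using smooth_deriv[OF h(2)] by (intro bexI[of _ "\<lambda>x. (a * c) * deriv f (c * x + d)"]) auto
qed (use assms in \<open>auto intro!: exI[of _ 1] exI[of _ f]\<close>)

text \<open>The classical function \<open>exp (- e / x)\<close>, flat at the origin. The polynomial
  in \<open>1/x\<close> is there to make the family closed under differentiation; \<open>e\<close>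
  will tend to 0 so that products of such functions approximate indicators.\<close>

definition half_bump :: "real \<Rightarrow> real poly \<Rightarrow> real \<Rightarrow> real" where
  "half_bump e q x = (if x > 0 then poly q (1/x) * exp (- e / x) else 0)"

lemma poly_exp_tendsto_0:
  assumes "e > 0"
  shows "((\<lambda>y::real. poly q y * exp (- e * y)) \<longlongrightarrow> 0) at_top"
proof -
  have "((\<lambda>y::real. \<Sum>i\<le>degree q. coeff q i * (y ^ i * exp (- e * y))) \<longlongrightarrow> (\<Sum>i\<le>degree q. coeff q i * 0)) at_top"
  proof (intro tendsto_intros)
    fix i show "((\<lambda>y::real. y ^ i * exp (- e * y)) \<longlongrightarrow> 0) at_top"
      using assms by real_asymp
  qed
  then show ?thesis by (simp add: poly_altdef sum_distrib_right mult.assoc)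
qed

lemma half_bump_tendsto:
  assumes "e > 0" shows "(half_bump e q \<longlongrightarrow> 0) (at 0)"
proof -
  have "(half_bump e q \<longlongrightarrow> 0) (at_right 0)"
  proof (rule Lim_transform_eventually)
    have "((\<lambda>x::real. 1 / x) \<longlongrightarrow> (0::real)) at_top" by real_asymp
    have "LIM x at_right (0::real). 1 / x :> at_top" by real_asymp
    from filterlim_compose[OF poly_exp_tendsto_0[OF assms] this]
    show "((\<lambda>x. poly q (1/x) * exp (- e * (1/x))) \<longlongrightarrow> 0) (at_right 0)" .
    show "\<forall>\<^sub>F x in at_right 0. poly q (1 / x) * exp (- e * (1 / x)) = half_bump e q x"
      unfolding half_bump_def by (auto simp: eventually_at_filter)
  qed
  moreover have "(half_bump e q \<longlongrightarrow> 0) (at_left 0)"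
    by (rule Lim_transform_eventually[OF tendsto_const])
      (auto simp: eventually_at_filter half_bump_def)
  ultimately show ?thesis by (simp add: filterlim_split_at)
qed

text \<open>For positive \<open>x\<close> the factor \<open>q(1/x)\<close> contributes
  \<open>- q'(1/x) / x^2\<close> and the exponential contributes \<open>e / x^2\<close>, whence the
  polynomial \<open>monom 1 2 * (smult e q - pderiv q)\<close>.\<close>

lemma half_bump_deriv:
  assumes "e > 0"
  shows "(half_bump e q has_real_derivative half_bump e (monom 1 2 * (smult e q - pderiv q)) x) (at x)"
proof -
  consider "x > 0" | "x < 0" | "x = 0" by linarith
  then show ?thesis
  proof cases
    case 1
    have "((\<lambda>x. poly q (1/x) * exp (- e / x)) has_real_derivative half_bump e (monom 1 2 * (smult e q - pderiv q)) x) (at x)"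
      using 1 by (auto intro!: derivative_eq_intros DERIV_chain'[OF _ poly_DERIV]
        simp: half_bump_def poly_monom power2_eq_square field_simps)
    then show ?thesis
      by (rule DERIV_cong_ev[THEN iffD1, OF refl _ refl, rotated])
        (use 1 eventually_nhds_in_open[of "{0<..}" x] in
          \<open>auto simp: half_bump_def elim!: eventually_mono\<close>)
  next
    case 2
    have "((\<lambda>x. 0) has_real_derivative half_bump e (monom 1 2 * (smult e q - pderiv q)) x) (at x)"
      using 2 by (auto simp: half_bump_def)
    then show ?thesis
      by (rule DERIV_cong_ev[THEN iffD1, OF refl _ refl, rotated])
        (use 2 eventually_nhds_in_open[of "{..<0}" x] in
          \<open>auto simp: half_bump_def elim!: eventually_mono\<close>)
  next
    case 3
    \<comment> \<open>At the origin the difference quotient is itself a member of the family: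
      dividing by \<open>h\<close> multiplies the polynomial by its variable, which stands for
      \<open>1/h\<close>.\<close>
    have "(half_bump e (monom 1 1 * q) \<longlongrightarrow> 0) (at 0)"
      by (rule half_bump_tendsto[OF assms])
    also have "half_bump e (monom 1 1 * q) = (\<lambda>h. (half_bump e q (0 + h) - half_bump e q 0) / h)"
      by (auto simp: half_bump_def poly_monom)
    finally show ?thesis
      unfolding DERIV_def 3 by (simp add: half_bump_def[of e _ 0])
  qed
qed

lemma smooth_half_bump: "e > 0 \<Longrightarrow> smooth (half_bump e q)"
  by (rule smoothI_closed[of "range (half_bump e)"]) (auto intro: half_bump_deriv)

text \<open>Positive exactly on the open interval, bounded by 1, and convergent to its indicator as
  \<open>e\<close> tends to 0. Where positivity alone matters, \<open>e = 1\<close> is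
  taken.\<close>

definition bump :: "real \<Rightarrow> real \<Rightarrow> real \<Rightarrow> real \<Rightarrow> real" where
  "bump e a b x = half_bump e 1 (x - a) * half_bump e 1 (b - x)"

lemma test_funI: "smooth f \<Longrightarrow> (\<And>x. \<bar>x\<bar> > R \<Longrightarrow> f x = 0) \<Longrightarrow> test_fun f"
  unfolding test_fun_def smooth_def by blast

lemma test_fun_smooth: "test_fun f \<Longrightarrow> smooth f"
  unfolding test_fun_def smooth_def by blast

lemma test_fun_support:
  assumes "test_fun f" obtains R where "R > 0" "\<And>x. \<bar>x\<bar> > R \<Longrightarrow> f x = 0" "\<And>x. \<bar>x\<bar> > R \<Longrightarrow> deriv f x = 0"
proof -
  obtain R where R: "\<And>x. \<bar>x\<bar> > R \<Longrightarrow> f x = 0" using assms unfolding test_fun_def by blast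
  have "deriv f x = 0" if "\<bar>x\<bar> > R" for x
  proof -
    have "open {x. \<bar>x\<bar> > R}" by (intro open_Collect_less continuous_intros)
    then have "\<forall>\<^sub>F y in nhds x. f y = 0"
      using that R eventually_nhds by (auto simp: eventually_nhds)
    then have "deriv f x = deriv (\<lambda>x. 0) x"
      by (intro deriv_cong_ev) auto
    then show ?thesis by simp
  qed
  then show ?thesis using R by (intro that[of "max R 1"]) auto
qed

lemma bump_eq_0: "x \<notin> {a<..<b} \<Longrightarrow> bump e a b x = 0"
  by (auto simp: bump_def half_bump_def)

lemma bump_bounds: "e \<ge> 0 \<Longrightarrow> 0 \<le> bump e a b x" "e \<ge> 0 \<Longrightarrow> bump e a b x \<le> 1"
proof -
  have "0 \<le> half_bump e 1 x \<and> half_bump e 1 x \<le> 1" if "e \<ge> 0" for x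
    using that by (auto simp: half_bump_def)
  then show "e \<ge> 0 \<Longrightarrow> 0 \<le> bump e a b x" "e \<ge> 0 \<Longrightarrow> bump e a b x \<le> 1"
    unfolding bump_def by (auto intro: mult_le_one)
qed

lemma bump_pos: "x \<in> {a<..<b} \<Longrightarrow> bump e a b x > 0"
  by (auto simp: bump_def half_bump_def)

lemma bump_tendsto: "(\<lambda>n. bump (1 / real (Suc n)) a b x) \<longlonglongrightarrow> indicator {a<..<b} x"
proof (cases "x \<in> {a<..<b}")
  case True
  have "(\<lambda>n. exp (- (1 / real (Suc n)) / c)) \<longlonglongrightarrow> 1" for c :: real
    by (cases "c = 0") (simp, real_asymp)
  from tendsto_mult[OF this this] show ?thesis
    using True by (simp add: bump_def half_bump_def)
qed (simp add: bump_eq_0)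

lemma test_fun_bump: "e > 0 \<Longrightarrow> test_fun (bump e a b)"
proof (rule test_funI)
  assume "e > 0"
  have "bump e a b = (\<lambda>x. half_bump e 1 (1 * x + (- a)) * half_bump e 1 ((- 1) * x + b))"
    by (auto simp: bump_def fun_eq_iff)
  then show "smooth (bump e a b)"
    using smooth_affine[OF smooth_half_bump[OF \<open>e > 0\<close>, of 1]] by (auto intro!: smooth_mult simp only:)
  show "\<bar>x\<bar> > max \<bar>a\<bar> \<bar>b\<bar> \<Longrightarrow> bump e a b x = 0" for x
    by (rule bump_eq_0) auto
qed

section \<open>Primitives of locally integrable functions\<close>

definition locally_integrable :: "(real \<Rightarrow> real) \<Rightarrow> bool" where
  "locally_integrable g \<longleftrightarrow> (\<forall>a b. integrable lborel (\<lambda>x. indicator {a..b} x * g x))"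

text \<open>Local absolute continuity of \<open>F\<close> with density \<open>g\<close>, stated
  through increments, so that almost everywhere differentiability never enters.\<close>

definition antideriv :: "(real \<Rightarrow> real) \<Rightarrow> (real \<Rightarrow> real) \<Rightarrow> bool" where
  "antideriv F g \<longleftrightarrow> locally_integrable g \<and>
     (\<forall>a b. a \<le> b \<longrightarrow> F b - F a = (\<integral>x. indicator {a..b} x * g x \<partial>lborel))"

lemma locally_integrableD: "locally_integrable g \<Longrightarrow> integrable lborel (\<lambda>x. indicator {a..b} x * g x)"
  unfolding locally_integrable_def by blast

lemma antideriv_locally_integrable: "antideriv F g \<Longrightarrow> locally_integrable g"
  unfolding antideriv_def by blast

lemma antiderivD: "antideriv F g \<Longrightarrow> a \<le> b \<Longrightarrow> F b - F a = (\<integral>x. indicator {a..b} x * g x \<partial>lborel)"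
  unfolding antideriv_def by blast

lemma locally_integrable_measurable[measurable_dest]:
  assumes "locally_integrable g" shows "g \<in> borel_measurable borel"
proof (rule borel_measurable_LIMSEQ_real)
  fix n :: nat
  show "(\<lambda>x. indicator {- real n..real n} x * g x) \<in> borel_measurable borel"
    using borel_measurable_integrable[OF locally_integrableD[OF assms]] by simp
next
  fix x :: real
  obtain N where N: "\<bar>x\<bar> \<le> real N" using real_arch_simple by blast
  have "\<forall>\<^sub>F n in sequentially. indicator {- real n..real n} x * g x = g x"
    using eventually_ge_at_top[of N] proof eventually_elim
    case (elim n)
    then have "x \<in> {- real n..real n}" using N by auto
    then show ?case by simp
  qed
  then show "(\<lambda>n. indicator {- real n..real n} x * g x) \<longlonglongrightarrow> g x"
    by (rule tendsto_eventually)
qed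

lemma integrable_mult_continuous:
  assumes "locally_integrable g" "continuous_on {a..b} \<phi>" "\<phi> \<in> borel_measurable borel"
  shows "integrable lborel (\<lambda>x. indicator {a..b} x * (g x * \<phi> x))"
proof -
  note [measurable] = locally_integrable_measurable[OF assms(1)] assms(3)
  obtain K where K: "\<And>x. x \<in> {a..b} \<Longrightarrow> \<bar>\<phi> x\<bar> \<le> K"
    using compact_imp_bounded[OF compact_continuous_image[OF assms(2) compact_Icc]]
    unfolding bounded_iff by fastforce
  show ?thesis
  proof (rule Bochner_Integration.integrable_bound[OF integrable_mult_right[OF locally_integrableD[OF assms(1), of a b], of K]])
    have "\<bar>g x\<bar> * \<bar>\<phi> x\<bar> \<le> \<bar>K\<bar> * \<bar>g x\<bar>" if "x \<in> {a..b}" for x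
      using mult_right_mono[OF K[OF that], of "\<bar>g x\<bar>"] mult_right_mono[OF abs_ge_self[of K], of "\<bar>g x\<bar>"]
      by (simp add: mult.commute)
    then show "AE x in lborel. norm (indicator {a..b} x * (g x * \<phi> x)) \<le> norm (K * (indicator {a..b} x * g x))"
      by (auto simp: indicator_def abs_mult)
  qed measurable
qed

lemma locally_integrable_continuous:
  assumes "continuous_on UNIV f" shows "locally_integrable f"
  unfolding locally_integrable_def
  using borel_integrable_compact[OF compact_Icc continuous_on_subset[OF assms subset_UNIV]] by simp

lemma locally_integrable_diff:
  "locally_integrable f \<Longrightarrow> locally_integrable g \<Longrightarrow> locally_integrable (\<lambda>x. f x - g x)"
  unfolding locally_integrable_def by (simp add: right_diff_distrib)

lemma locally_integrable_add:
  "locally_integrable f \<Longrightarrow> locally_integrable g \<Longrightarrow> locally_integrable (\<lambda>x. f x + g x)"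
  unfolding locally_integrable_def by (simp add: distrib_left)

lemma antideriv_add: "antideriv F f \<Longrightarrow> antideriv G g \<Longrightarrow> antideriv (\<lambda>x. F x + G x) (\<lambda>x. f x + g x)"
  unfolding antideriv_def
  by (auto simp: locally_integrable_add distrib_left locally_integrableD
    Bochner_Integration.integral_add add_diff_add)

lemma antideriv_diff:
  assumes "antideriv F f" "antideriv G g" shows "antideriv (\<lambda>x. F x - G x) (\<lambda>x. f x - g x)"
proof -
  have "F b - G b - (F a - G a) = (\<integral>x. indicator {a..b} x * (f x - g x) \<partial>lborel)" if "a \<le> b" for a b
    using antiderivD[OF assms(1) that] antiderivD[OF assms(2) that]
      locally_integrableD[OF antideriv_locally_integrable[OF assms(1)], of a b]
      locally_integrableD[OF antideriv_locally_integrable[OF assms(2)], of a b]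
    by (simp only: right_diff_distrib Bochner_Integration.integral_diff)
  then show ?thesis
    using assms antideriv_locally_integrable locally_integrable_diff unfolding antideriv_def by blast
qed

lemma antideriv_C1:
  assumes "\<And>x. (F has_real_derivative f x) (at x)" "continuous_on UNIV f"
  shows "antideriv F f"
  unfolding antideriv_def
proof (intro conjI allI impI locally_integrable_continuous assms)
  fix a b :: real assume "a \<le> b"
  show "F b - F a = (\<integral>x. indicator {a..b} x * f x \<partial>lborel)"
    using integral_FTC_atLeastAtMost[OF \<open>a \<le> b\<close>, of F f] assms
    by (simp add: has_real_derivative_iff_has_vector_derivative[symmetric]
      has_field_derivative_at_within continuous_on_subset[OF assms(2)])
qed

lemma antideriv_exists:
  assumes "locally_integrable g"
  obtains F where "antideriv F g"
proof
  \<comment> \<open>The difference of indicators is that of \<open>(0, x]\<close> for positive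
    \<open>x\<close> and minus that of \<open>(x, 0]\<close> for negative \<open>x\<close>: the
    oriented integral from 0 to \<open>x\<close>.\<close>
  define F where "F x = (\<integral>y. (indicator {..x} y - indicator {..0} y) * g y \<partial>lborel)" for x
  note [measurable] = locally_integrable_measurable[OF assms]
  have int: "integrable lborel (\<lambda>y. (indicator {..x} y - indicator {..0} y) * g y)" for x
    by (rule Bochner_Integration.integrable_bound[OF locally_integrableD[OF assms, of "-\<bar>x\<bar>" "\<bar>x\<bar>"]])
      (auto simp: indicator_def)
  have "F b - F a = (\<integral>x. indicator {a..b} x * g x \<partial>lborel)" if "a \<le> b" for a b
  proof -
    have "F b - F a = (\<integral>y. (indicator {..b} y - indicator {..0} y) * g y - (indicator {..a} y - indicator {..0} y) * g y \<partial>lborel)"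
      unfolding F_def by (rule Bochner_Integration.integral_diff[symmetric]; rule int)
    also have "\<dots> = (\<integral>x. indicator {a..b} x * g x \<partial>lborel)"
    proof (rule integral_cong_AE)
      show "AE y in lborel. (indicator {..b} y - indicator {..0} y) * g y - (indicator {..a} y - indicator {..0} y) * g y
        = indicator {a..b} y * g y"
        using AE_lborel_singleton[of a] by (rule eventually_mono) (use that in \<open>auto simp: indicator_def\<close>)
    qed measurable
    finally show ?thesis .
  qed
  then show "antideriv F g" unfolding antideriv_def using assms by blast
qed

lemma antideriv_continuous:
  assumes "antideriv F g" shows "continuous_on UNIV F"
proof -
  have lg: "locally_integrable g" using assms by (rule antideriv_locally_integrable)
  have "continuous_on {-R..R} F" for R
  proof -
    have int: "(\<lambda>x. indicator {-R..R} x * g x) integrable_on {-R..R}"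
      by (rule integrable_on_subinterval[OF integrable_on_lborel[OF locally_integrableD[OF lg]] subset_UNIV])
    have eq: "F x = F (-R) + integral {-R..x} (\<lambda>x. indicator {-R..R} x * g x)" if "x \<in> {-R..R}" for x
    proof -
      have "F x - F (-R) = (\<integral>y. indicator {-R..x} y * g y \<partial>lborel)"
        using that by (intro antiderivD[OF assms]) auto
      also have "\<dots> = integral {-R..x} g"
        using set_borel_integral_eq_integral(2)[of "{-R..x}" g] locally_integrableD[OF lg]
        by (simp add: set_integrable_def set_lebesgue_integral_def)
      also have "\<dots> = integral {-R..x} (\<lambda>x. indicator {-R..R} x * g x)"
        using that by (intro integral_cong) auto
      finally show ?thesis by simp
    qed
    have "continuous_on {-R..R} (\<lambda>x. F (-R) + integral {-R..x} (\<lambda>x. indicator {-R..R} x * g x))"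
      by (intro continuous_intros indefinite_integral_continuous_1 int)
    then show ?thesis by (rule continuous_on_eq) (rule eq[symmetric])
  qed
  then have "isCont F x" for x
    by (rule continuous_on_interior[of "{-(\<bar>x\<bar>+1)..\<bar>x\<bar>+1}"]) auto
  then show ?thesis by (simp add: continuous_at_imp_continuous_on)
qed

lemma antideriv_measurable: "antideriv F g \<Longrightarrow> F \<in> borel_measurable borel"
  by (rule borel_measurable_continuous_onI[OF antideriv_continuous])

text \<open>\<open>F\<close> need not be differentiable at any given point, so the product rule is
  replaced by Fubini's theorem for \<open>\<phi>'(x) g(y)\<close> on the triangle
  \<open>a \<le> y \<le> x \<le> b\<close>. Integrating in \<open>y\<close> first gives
  \<open>\<phi>'(x) (F x - F a)\<close>, integrating in \<open>x\<close> first gives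
  \<open>g(y) (\<phi> b - \<phi> y)\<close>.\<close>

lemma antideriv_by_parts:
  assumes F: "antideriv F g" and \<phi>: "\<And>x. (\<phi> has_real_derivative \<phi>' x) (at x)" "continuous_on UNIV \<phi>'"
  shows "antideriv (\<lambda>x. F x * \<phi> x) (\<lambda>x. F x * \<phi>' x + g x * \<phi> x)"
proof -
  have lg: "locally_integrable g" using F by (rule antideriv_locally_integrable)
  have contF: "continuous_on UNIV F" using F by (rule antideriv_continuous)
  have cont\<phi>: "continuous_on UNIV \<phi>" by (rule DERIV_continuous_on[OF \<phi>(1)]) 
  have [measurable]: "F \<in> borel_measurable borel" "\<phi> \<in> borel_measurable borel" "\<phi>' \<in> borel_measurable borel"
    using contF cont\<phi> \<phi>(2) by (auto intro: borel_measurable_continuous_onI)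
  note [measurable] = locally_integrable_measurable[OF lg]
  have lF\<phi>: "locally_integrable (\<lambda>x. F x * \<phi>' x)"
    by (intro locally_integrable_continuous continuous_intros contF \<phi>)
  have lg\<phi>: "locally_integrable (\<lambda>x. g x * \<phi> x)"
    unfolding locally_integrable_def
    by (intro allI integrable_mult_continuous lg continuous_on_subset[OF cont\<phi>]) auto
  have a\<phi>: "antideriv \<phi> \<phi>'" using \<phi> by (rule antideriv_C1)
  have "F b * \<phi> b - F a * \<phi> a = (\<integral>x. indicator {a..b} x * (F x * \<phi>' x + g x * \<phi> x) \<partial>lborel)" if "a \<le> b" for a b
  proof -
    define P where "P x = indicator {a..b} x * \<phi>' x" for x
    define G where "G y = indicator {a..b} y * g y" for y
    have [measurable]: "P \<in> borel_measurable borel" "G \<in> borel_measurable borel"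
      unfolding P_def G_def by measurable
    have intP: "integrable lborel P"
      unfolding P_def using a\<phi> antideriv_locally_integrable locally_integrableD by blast
    have intG: "integrable lborel G" unfolding G_def by (rule locally_integrableD[OF lg])
    have "integrable (lborel \<Otimes>\<^sub>M lborel) (\<lambda>(x, y). P x * G y)"
    proof (rule lborel_pair.Fubini_integrable)
      show "integrable lborel (\<lambda>x. \<integral>y. norm (case (x, y) of (x, y) \<Rightarrow> P x * G y) \<partial>lborel)"
        using intP by (simp add: abs_mult)
      show "AE x in lborel. integrable lborel (\<lambda>y. case (x, y) of (x, y) \<Rightarrow> P x * G y)"
        using intG by simp
    qed measurable
    then have int2: "integrable (lborel \<Otimes>\<^sub>M lborel) (\<lambda>(x, y). P x * G y * (if y \<le> x then 1 else 0))"
      by (rule Bochner_Integration.integrable_bound) auto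
    have inner1: "(\<integral>y. P x * G y * (if y \<le> x then 1 else 0) \<partial>lborel) = P x * (F x - F a)" for x
    proof (cases "x \<in> {a..b}")
      case True
      then have "F x - F a = (\<integral>y. indicator {a..x} y * g y \<partial>lborel)" by (intro antiderivD[OF F]) auto
      also have "\<dots> = (\<integral>y. G y * (if y \<le> x then 1 else 0) \<partial>lborel)"
        using True by (intro Bochner_Integration.integral_cong) (auto simp: G_def indicator_def)
      finally show ?thesis by (simp add: mult.assoc)
    qed (simp add: P_def)
    have inner2: "(\<integral>x. P x * G y * (if y \<le> x then 1 else 0) \<partial>lborel) = G y * (\<phi> b - \<phi> y)" for y
    proof (cases "y \<in> {a..b}")
      case True
      then have "\<phi> b - \<phi> y = (\<integral>x. indicator {y..b} x * \<phi>' x \<partial>lborel)" by (intro antiderivD[OF a\<phi>]) auto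
      also have "\<dots> = (\<integral>x. P x * (if y \<le> x then 1 else 0) \<partial>lborel)"
        using True by (intro Bochner_Integration.integral_cong) (auto simp: P_def indicator_def)
      finally have "G y * (\<phi> b - \<phi> y) = (\<integral>x. G y * (P x * (if y \<le> x then 1 else 0)) \<partial>lborel)"
        by (simp only: integral_mult_right_zero)
      then show ?thesis by (simp only: mult.left_commute mult.assoc)
    qed (simp add: G_def)
    have eq: "(\<integral>y. G y * (\<phi> b - \<phi> y) \<partial>lborel) = (\<integral>x. P x * (F x - F a) \<partial>lborel)"
      using lborel_pair.Fubini_integral[OF int2] unfolding inner1 inner2 .
    have intPF: "integrable lborel (\<lambda>x. P x * F x)"
      using locally_integrableD[OF lF\<phi>, of a b] by (simp add: P_def ac_simps)
    have intG\<phi>: "integrable lborel (\<lambda>x. G x * \<phi> x)"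
      using locally_integrableD[OF lg\<phi>, of a b] by (simp add: G_def ac_simps)
    have "(\<integral>x. indicator {a..b} x * (F x * \<phi>' x + g x * \<phi> x) \<partial>lborel) = (\<integral>x. P x * F x + G x * \<phi> x \<partial>lborel)"
      by (intro Bochner_Integration.integral_cong) (auto simp: P_def G_def algebra_simps)
    also have "\<dots> = (\<integral>x. P x * F x \<partial>lborel) + (\<integral>x. G x * \<phi> x \<partial>lborel)"
      using intPF intG\<phi> by simp
    also have "(\<integral>x. P x * F x \<partial>lborel) = (\<integral>x. P x * (F x - F a) \<partial>lborel) + F a * (\<integral>x. P x \<partial>lborel)"
      using intPF intP by (simp add: right_diff_distrib)
    also have "(\<integral>x. G x * \<phi> x \<partial>lborel) = \<phi> b * (\<integral>x. G x \<partial>lborel) - (\<integral>y. G y * (\<phi> b - \<phi> y) \<partial>lborel)"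
      using intG\<phi> intG by (simp add: right_diff_distrib)
    also have "(\<integral>x. P x \<partial>lborel) = \<phi> b - \<phi> a"
      unfolding P_def by (rule antiderivD[OF a\<phi> that, symmetric])
    also have "(\<integral>x. G x \<partial>lborel) = F b - F a"
      unfolding G_def by (rule antiderivD[OF F that, symmetric])
    finally show ?thesis using eq by (simp add: algebra_simps)
  qed
  then show ?thesis
    unfolding antideriv_def using locally_integrable_add[OF lF\<phi> lg\<phi>] by blast
qed

section \<open>Primitives have their densities as weak derivatives\<close>

lemma test_fun_continuous: "test_fun \<phi> \<Longrightarrow> continuous_on UNIV \<phi>" "test_fun \<phi> \<Longrightarrow> continuous_on UNIV (deriv \<phi>)"
  using DERIV_continuous_on[OF has_field_derivative_at_within[OF smooth_has_deriv]]
  by (blast intro: test_fun_smooth smooth_deriv)+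

lemma integrable_mult_test_fun:
  assumes "locally_integrable g" "continuous_on UNIV \<phi>" "\<And>x. \<bar>x\<bar> > R \<Longrightarrow> \<phi> x = 0"
  shows "integrable lborel (\<lambda>x. g x * \<phi> x)"
proof -
  have "(\<lambda>x. g x * \<phi> x) = (\<lambda>x. indicator {-R..R} x * (g x * \<phi> x))"
  proof
    fix x show "g x * \<phi> x = indicator {-R..R} x * (g x * \<phi> x)"
      using assms(3)[of x] by (cases "\<bar>x\<bar> > R") (auto simp: indicator_def)
  qed
  then show ?thesis
    using integrable_mult_continuous[OF assms(1) continuous_on_subset[OF assms(2)], of "-R" R] assms(2)
    by (auto intro: borel_measurable_continuous_onI)
qed

lemma antideriv_weak_deriv:
  assumes "antideriv F g" shows "is_weak_deriv F g"
  unfolding is_weak_deriv_def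
proof (intro conjI allI impI)
  have lg: "locally_integrable g" using assms by (rule antideriv_locally_integrable)
  show "g \<in> borel_measurable lborel" using locally_integrable_measurable[OF lg] by simp
  fix \<phi> assume \<phi>: "test_fun \<phi>"
  obtain R where R: "R > 0" "\<And>x. \<bar>x\<bar> > R \<Longrightarrow> \<phi> x = 0" "\<And>x. \<bar>x\<bar> > R \<Longrightarrow> deriv \<phi> x = 0"
    using test_fun_support[OF \<phi>] by blast
  show i1: "integrable lborel (\<lambda>x. F x * deriv \<phi> x)"
    using assms by (intro integrable_mult_test_fun[OF _ _ R(3)] locally_integrable_continuous
      antideriv_continuous test_fun_continuous \<phi>)
  show i2: "integrable lborel (\<lambda>x. g x * \<phi> x)"
    by (intro integrable_mult_test_fun[OF _ _ R(2)] lg test_fun_continuous \<phi>)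
  have "antideriv (\<lambda>x. F x * \<phi> x) (\<lambda>x. F x * deriv \<phi> x + g x * \<phi> x)"
    by (rule antideriv_by_parts[OF assms smooth_has_deriv[OF test_fun_smooth[OF \<phi>]] test_fun_continuous(2)[OF \<phi>]])
  \<comment> \<open>The margin 1 puts the endpoints strictly outside \<open>[-R, R]\<close>, where
    \<open>\<phi>\<close> is known to vanish; hence no boundary terms.\<close>
  from antiderivD[OF this, of "-R-1" "R+1"]
  have "0 = (\<integral>x. indicator {-R-1..R+1} x * (F x * deriv \<phi> x + g x * \<phi> x) \<partial>lborel)"
    using R(1) R(2)[of "-R-1"] R(2)[of "R+1"] by simp
  also have "\<dots> = (\<integral>x. F x * deriv \<phi> x + g x * \<phi> x \<partial>lborel)"
  proof (rule Bochner_Integration.integral_cong[OF refl])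
    fix x show "indicator {-R-1..R+1} x * (F x * deriv \<phi> x + g x * \<phi> x) = F x * deriv \<phi> x + g x * \<phi> x"
      using R(2,3)[of x] by (cases "\<bar>x\<bar> > R") (auto simp: indicator_def)
  qed
  finally show "(\<integral>x. F x * deriv \<phi> x \<partial>lborel) = - (\<integral>x. g x * \<phi> x \<partial>lborel)"
    using i1 i2 by simp
qed

text \<open>Dynkin's pi-lambda theorem for the open intervals, which are stable under intersection
  and generate the Borel sets.\<close>

lemma borel_interval_induct [consumes 1, case_names interval empty compl union]:
  fixes A :: "real set"
  assumes "A \<in> sets borel"
    and "\<And>a b. P {a<..<b}" "P {}"
    and "\<And>A. A \<in> sets borel \<Longrightarrow> P A \<Longrightarrow> P (- A)"
    and "\<And>A::nat \<Rightarrow> real set. disjoint_family A \<Longrightarrow> range A \<subseteq> sets borel \<Longrightarrow> (\<And>i. P (A i)) \<Longrightarrow> P (\<Union>i. A i)"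
  shows "P A"
proof -
  define G :: "real set set" where "G = range (\<lambda>(a, b). {a<..<b})"
  have sb: "sigma_sets UNIV G = sets borel"
    unfolding G_def borel_eq_box box_real by simp
  have "Int_stable G"
    unfolding Int_stable_def G_def by (auto simp: Int_greaterThanLessThan)
  moreover have "G \<subseteq> Pow UNIV" by simp
  moreover have "A \<in> sigma_sets UNIV G" using assms(1) sb by simp
  ultimately show ?thesis
  proof (induction rule: sigma_sets_induct_disjoint)
    case (basic A) then show ?case using assms(2) by (auto simp: G_def)
  next
    case (compl A) then show ?case using assms(4) sb by (simp add: Compl_eq_Diff_UNIV)
  qed (use assms sb in auto)
qed

text \<open>Truncated to \<open>(-n, n)\<close>, the function is integrable and its integrals over
  Borel sets are countably additive, so they all vanish by \<open>borel_interval_induct\<close>; a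
  density with zero integral over every set is zero almost everywhere.\<close>

lemma AE_zero_if_interval_integrals_zero:
  assumes lh: "locally_integrable h" and z: "\<And>a b. (\<integral>x. indicator {a<..<b} x * h x \<partial>lborel) = 0"
  shows "AE x in lborel. h x = 0"
proof -
  have "AE x in lborel. indicator {- real n<..<real n} x * h x = 0" for n
  proof -
    define k where "k x = indicator {- real n<..<real n} x * h x" for x
    have [measurable]: "h \<in> borel_measurable borel" using lh by (rule locally_integrable_measurable)
    have [measurable]: "k \<in> borel_measurable borel" unfolding k_def by measurable
    have int: "integrable lborel k"
      unfolding k_def
      by (rule Bochner_Integration.integrable_bound[OF locally_integrableD[OF lh, of "- real n" "real n"]])
       (auto simp: indicator_def)
    have intA: "integrable lborel (\<lambda>x. indicator A x * k x)" if "A \<in> sets borel" for A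
      using that by (intro Bochner_Integration.integrable_bound[OF int]) (auto simp: indicator_def)
    have "(\<integral>x. indicator A x * k x \<partial>lborel) = 0" if "A \<in> sets borel" for A
      using that
    proof (induction rule: borel_interval_induct)
      case (interval a b)
      have "(\<integral>x. indicator {a<..<b} x * k x \<partial>lborel) = (\<integral>x. indicator {max a (- real n)<..<min b (real n)} x * h x \<partial>lborel)"
        by (intro Bochner_Integration.integral_cong) (auto simp: k_def indicator_def)
      then show ?case using z by simp
    next
      case (compl A)
      have "(\<integral>x. k x \<partial>lborel) = 0" unfolding k_def by (rule z)
      moreover have "(\<integral>x. indicator (- A) x * k x \<partial>lborel) = (\<integral>x. k x - indicator A x * k x \<partial>lborel)"
        by (intro Bochner_Integration.integral_cong) (auto simp: indicator_def)
      ultimately show ?case using compl intA int by simp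
    next
      case (union A)
      have "(LINT x:(\<Union>i. A i)|lborel. k x) = (\<Sum>i. LINT x:A i|lborel. k x)"
      proof (rule lebesgue_integral_countable_add)
        show "A i \<inter> A j = {}" if "i \<noteq> j" for i j
          using union(1) that by (auto simp: disjoint_family_on_def)
        show "set_integrable lborel (\<Union>i. A i) k"
          unfolding set_integrable_def using union(2) by (simp add: intA sets.countable_UN)
      qed (use union(2) in auto)
      then show ?case using union(3) by (simp add: set_lebesgue_integral_def)
    qed simp
    then have "AE x in lborel. k x = 0"
      using int by (intro density_unique_real) (auto simp: set_lebesgue_integral_def)
    then show ?thesis unfolding k_def .
  qed
  then have "AE x in lborel. \<forall>n. indicator {- real n<..<real n} x * h x = 0"
    by (intro AE_all_countable[THEN iffD2] allI)
  then show ?thesis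
  proof eventually_elim
    case (elim x)
    obtain n where "\<bar>x\<bar> < real n" using reals_Archimedean2 by blast
    then have "x \<in> {- real n<..<real n}" by auto
    then show ?case using spec[OF elim, of n] by simp
  qed
qed

text \<open>The bumps on \<open>(a, b)\<close> with \<open>e = 1 / (n + 1)\<close> converge
  boundedly to the indicator, so dominated convergence passes from test functions to
  intervals.\<close>

lemma AE_zero_if_test_integrals_zero:
  assumes lh: "locally_integrable h" and z: "\<And>\<phi>. test_fun \<phi> \<Longrightarrow> (\<integral>x. h x * \<phi> x \<partial>lborel) = 0"
  shows "AE x in lborel. h x = 0"
proof (rule AE_zero_if_interval_integrals_zero[OF lh])
  fix a b
  note [measurable] = locally_integrable_measurable[OF lh]
  have [measurable]: "bump e a b \<in> borel_measurable borel" if "e > 0" for e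
    using test_fun_continuous(1)[OF test_fun_bump[OF that]] by (rule borel_measurable_continuous_onI)
  have "(\<lambda>n. \<integral>x. h x * bump (1 / real (Suc n)) a b x \<partial>lborel) \<longlonglongrightarrow> (\<integral>x. h x * indicator {a<..<b} x \<partial>lborel)"
  proof (rule integral_dominated_convergence)
    show "integrable lborel (\<lambda>x. \<bar>indicator {a..b} x * h x\<bar>)"
      using locally_integrableD[OF lh] by simp
    show "AE x in lborel. (\<lambda>n. h x * bump (1 / real (Suc n)) a b x) \<longlonglongrightarrow> h x * indicator {a<..<b} x"
      by (intro AE_I2 tendsto_intros bump_tendsto)
    have "\<bar>h x * bump (1 / real (Suc n)) a b x\<bar> \<le> \<bar>indicator {a..b} x * h x\<bar>" for n x
    proof (cases "x \<in> {a<..<b}")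
      case True
      then show ?thesis using bump_bounds[of "1 / real (Suc n)" a b x] by (auto simp: abs_mult mult_left_le)
    qed (simp add: bump_eq_0)
    then show "AE x in lborel. norm (h x * bump (1 / real (Suc n)) a b x) \<le> \<bar>indicator {a..b} x * h x\<bar>" for n
      by simp
  qed measurable
  then have "(\<lambda>n. 0) \<longlonglongrightarrow> (\<integral>x. h x * indicator {a<..<b} x \<partial>lborel)"
    using z test_fun_bump by simp
  then show "(\<integral>x. indicator {a<..<b} x * h x \<partial>lborel) = 0"
    using LIMSEQ_unique[OF _ tendsto_const] by (simp add: mult.commute)
qed

section \<open>Weak derivatives are derivatives of primitives\<close>

text \<open>The primitive that vanishes to the left of the support is constant to its right, and
  that constant is the total integral; mean zero is exactly what makes the support compact.\<close>

lemma test_fun_antideriv: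
  assumes \<psi>: "test_fun \<psi>" and z: "(\<integral>x. \<psi> x \<partial>lborel) = 0"
  obtains \<phi> where "test_fun \<phi>" "deriv \<phi> = \<psi>"
proof -
  obtain R where R: "R > 0" "\<And>x. \<bar>x\<bar> > R \<Longrightarrow> \<psi> x = 0"
    using test_fun_support[OF \<psi>] by metis
  have cont: "continuous_on UNIV \<psi>" using \<psi> by (rule test_fun_continuous)
  then have "\<exists>F. \<forall>x. (F has_real_derivative \<psi> x) (at x)"
    unfolding has_real_derivative_iff_has_vector_derivative
    using einterval_antiderivative[of "-\<infinity>" \<infinity> \<psi>]
    by (simp add: continuous_on_eq_continuous_at)
  then obtain F where F: "\<And>x. (F has_real_derivative \<psi> x) (at x)" by blast
  have aF: "antideriv F \<psi>" using F cont by (rule antideriv_C1)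
  define \<phi> where "\<phi> x = F x - F (-R-1)" for x
  have d: "(\<phi> has_real_derivative \<psi> x) (at x)" for x
    unfolding \<phi>_def by (auto intro!: derivative_eq_intros F)
  have "\<phi> x = 0" if x: "\<bar>x\<bar> > R + 1" for x
  proof (cases "x > 0")
    case True
    have "\<phi> x = (\<integral>y. indicator {-R-1..x} y * \<psi> y \<partial>lborel)"
      unfolding \<phi>_def using x R(1) True by (intro antiderivD[OF aF]) auto
    also have "\<dots> = (\<integral>y. \<psi> y \<partial>lborel)"
    proof (rule Bochner_Integration.integral_cong[OF refl])
      fix y show "indicator {-R-1..x} y * \<psi> y = \<psi> y"
        using R(2)[of y] x True by (cases "\<bar>y\<bar> > R") (auto simp: indicator_def)
    qed
    finally show ?thesis using z by simp
  next
    case False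
    have "F (-R-1) - F x = (\<integral>y. indicator {x..-R-1} y * \<psi> y \<partial>lborel)"
      using x R(1) False by (intro antiderivD[OF aF]) auto
    also have "\<dots> = (\<integral>y. 0 \<partial>(lborel :: real measure))"
    proof (rule Bochner_Integration.integral_cong[OF refl])
      fix y show "indicator {x..-R-1} y * \<psi> y = 0"
        using R(2)[of y] R(1) by (cases "\<bar>y\<bar> > R") (auto simp: indicator_def)
    qed
    finally show ?thesis unfolding \<phi>_def by simp
  qed
  then have "test_fun \<phi>" 
    by (rule test_funI[OF smooth_antideriv[OF test_fun_smooth[OF \<psi>] d]])
  moreover have "deriv \<phi> = \<psi>" by (rule ext) (rule DERIV_imp_deriv[OF d])
  ultimately show ?thesis using that by blast
qed

lemma test_fun_integrable: "test_fun \<phi> \<Longrightarrow> integrable lborel \<phi>"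
proof -
  assume a: "test_fun \<phi>"
  obtain R where R: "\<And>x. \<bar>x\<bar> > R \<Longrightarrow> \<phi> x = 0" using test_fun_support[OF a] by metis
  from integrable_mult_test_fun[OF locally_integrable_continuous[OF continuous_on_const[of _ 1]] test_fun_continuous(1)[OF a] R]
  show ?thesis by simp
qed

lemma test_fun_lincomb:
  assumes "test_fun f" "test_fun g" shows "test_fun (\<lambda>x. f x - c * g x)"
proof -
  obtain R where R: "\<And>x. \<bar>x\<bar> > R \<Longrightarrow> f x = 0" using test_fun_support[OF assms(1)] by metis
  obtain S where S: "\<And>x. \<bar>x\<bar> > S \<Longrightarrow> g x = 0" using test_fun_support[OF assms(2)] by metis
  have "smooth (\<lambda>x. f x + (- c) * g x)"
    by (rule smooth_add[OF test_fun_smooth[OF assms(1)] smooth_mult[OF smooth_const test_fun_smooth[OF assms(2)]]])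
  then have "smooth (\<lambda>x. f x - c * g x)" by simp
  then show ?thesis by (rule test_funI[of _ "max R S"]) (auto simp: R S)
qed

lemma bump_integral_pos: "(\<integral>x. bump 1 0 1 x \<partial>lborel) > 0"
proof -
  have int: "integrable lborel (bump 1 0 1)" by (intro test_fun_integrable test_fun_bump) simp
  have "(\<integral>x. bump 1 0 1 x \<partial>lborel) \<noteq> 0"
  proof
    assume "(\<integral>x. bump 1 0 1 x \<partial>lborel) = 0"
    then have "AE x in lborel. bump 1 0 1 x = 0"
      using integral_nonneg_eq_0_iff_AE[OF int] bump_bounds(1)[of 1] by simp
    then have "AE x in lborel. x \<notin> {0<..<1::real}"
      by eventually_elim (metis bump_pos less_irrefl)
    then have "{0<..<1::real} \<in> null_sets lborel"
      by (subst AE_iff_null_sets) auto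
    then show False by (auto simp: null_sets_def)
  qed
  then show ?thesis using bump_bounds(1)[of 1] by (simp add: Bochner_Integration.integral_nonneg less_le)
qed

text \<open>
  Subtracting a multiple of a fixed bump makes any test function mean-free, hence the derivative
  of a test function.
\<close>
lemma AE_const_if_weak_deriv_zero:
  assumes lk: "locally_integrable k" and z: "\<And>\<phi>. test_fun \<phi> \<Longrightarrow> (\<integral>x. k x * deriv \<phi> x \<partial>lborel) = 0"
  obtains c where "AE x in lborel. k x = c"
proof -
  let ?b = "bump 1 0 1"
  have tb: "test_fun ?b" by (rule test_fun_bump) simp
  have int: "integrable lborel (\<lambda>x. k x * \<eta> x)" if t\<eta>: "test_fun \<eta>" for \<eta>
  proof -
    obtain R where R: "\<And>x. \<bar>x\<bar> > R \<Longrightarrow> \<eta> x = 0" using test_fun_support[OF t\<eta>] by metis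
    show ?thesis by (rule integrable_mult_test_fun[OF lk test_fun_continuous(1)[OF t\<eta>] R])
  qed
  \<comment> \<open>The only candidate: if \<open>k\<close> equals a constant, pairing it with the
    bump returns this quotient.\<close>
  define c where "c = (\<integral>x. k x * ?b x \<partial>lborel) / (\<integral>x. ?b x \<partial>lborel)"
  have "AE x in lborel. k x - c = 0"
  proof (rule AE_zero_if_test_integrals_zero)
    show "locally_integrable (\<lambda>x. k x - c)"
      by (intro locally_integrable_diff lk locally_integrable_continuous continuous_on_const)
    fix \<eta> assume t\<eta>: "test_fun \<eta>"
    define m where "m = (\<integral>x. \<eta> x \<partial>lborel) / (\<integral>x. ?b x \<partial>lborel)"
    have i1: "integrable lborel \<eta>" "integrable lborel ?b" using t\<eta> tb test_fun_integrable by auto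
    have "(\<integral>x. \<eta> x - m * ?b x \<partial>lborel) = 0"
      using i1 bump_integral_pos by (simp add: m_def)
    from test_fun_antideriv[OF test_fun_lincomb[OF t\<eta> tb] this]
    obtain \<phi> where "test_fun \<phi>" "deriv \<phi> = (\<lambda>x. \<eta> x - m * ?b x)" by blast
    with z[of \<phi>] have "(\<integral>x. k x * (\<eta> x - m * ?b x) \<partial>lborel) = 0" by simp
    moreover have "(\<integral>x. k x * (\<eta> x - m * ?b x) \<partial>lborel) = (\<integral>x. k x * \<eta> x - m * (k x * ?b x) \<partial>lborel)"
      by (intro Bochner_Integration.integral_cong) (auto simp: algebra_simps)
    ultimately have "(\<integral>x. k x * \<eta> x \<partial>lborel) = m * (\<integral>x. k x * ?b x \<partial>lborel)"
      using int[OF t\<eta>] int[OF tb] by simp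
    also have "\<dots> = c * (\<integral>x. \<eta> x \<partial>lborel)" unfolding m_def c_def by simp
    finally show "(\<integral>x. (k x - c) * \<eta> x \<partial>lborel) = 0"
      using int[OF t\<eta>] i1 by (simp add: left_diff_distrib)
  qed
  then show ?thesis using that[of c] by simp
qed

text \<open>On \<open>[a, b]\<close> the weight is at least its positive minimum, so
  \<open>|g|\<close> is at most a constant times \<open>|g \<phi>|\<close>. This extracts local
  integrability from the definition of a weak derivative, which only speaks of integrals against
  test functions.\<close>

lemma locally_integrable_if_bump_mult:
  assumes "g \<in> borel_measurable borel" "\<And>a b. a < b \<Longrightarrow> \<exists>\<phi>. continuous_on UNIV \<phi> \<and> (\<forall>x\<in>{a..b}. \<phi> x > 0) \<and> integrable lborel (\<lambda>x. g x * \<phi> x)"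
  shows "locally_integrable g"
  unfolding locally_integrable_def
proof (intro allI)
  fix a b :: real
  note [measurable] = assms(1)
  show "integrable lborel (\<lambda>x. indicator {a..b} x * g x)"
  proof (cases "a \<le> b")
    case True
    then obtain \<phi> where \<phi>: "continuous_on UNIV \<phi>" "\<forall>x\<in>{a..b+1}. \<phi> x > 0" "integrable lborel (\<lambda>x. g x * \<phi> x)"
      using assms(2)[of a "b+1"] by auto
    then obtain y where "y \<in> {a..b}" "\<forall>x\<in>{a..b}. \<phi> y \<le> \<phi> x"
      using continuous_attains_inf[OF compact_Icc _ continuous_on_subset[OF \<phi>(1) subset_UNIV], of a b] True by auto
    then have y: "\<phi> y > 0" "\<And>x. x \<in> {a..b} \<Longrightarrow> \<phi> y \<le> \<phi> x" using \<phi>(2) by auto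
    have "\<bar>g x\<bar> \<le> (1 / \<phi> y) * \<bar>g x * \<phi> x\<bar>" if "x \<in> {a..b}" for x
      using y(1) y(2)[OF that] mult_right_mono[OF y(2)[OF that], of "\<bar>g x\<bar>"]
      by (simp add: abs_mult field_simps)
    then show ?thesis
      by (intro Bochner_Integration.integrable_bound[OF integrable_mult_right[OF \<phi>(3), of "1 / \<phi> y"]])
        (use y(1) in \<open>auto simp: indicator_def abs_mult\<close>)
  qed simp
qed

text \<open>The du Bois-Reymond argument: \<open>f\<close> minus a primitive of \<open>g\<close> has
  zero weak derivative, hence is constant almost everywhere, and the constant is absorbed into the
  primitive. Local integrability of \<open>f\<close> and \<open>g\<close> has to be established
  first.\<close>

lemma weak_deriv_antideriv:
  assumes wd: "is_weak_deriv f g" and mf[measurable]: "f \<in> borel_measurable borel"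
  obtains F where "antideriv F g" "AE x in lborel. f x = F x"
proof -
  have mg: "g \<in> borel_measurable borel" using wd by (simp add: is_weak_deriv_def)
  have lg: "locally_integrable g"
  proof (rule locally_integrable_if_bump_mult[OF mg])
    fix a b :: real
    have t: "test_fun (bump 1 (a - 1) (b + 1))" by (rule test_fun_bump) simp
    then show "\<exists>\<phi>. continuous_on UNIV \<phi> \<and> (\<forall>x\<in>{a..b}. \<phi> x > 0) \<and> integrable lborel (\<lambda>x. g x * \<phi> x)"
      using wd bump_pos test_fun_continuous(1)[OF t] unfolding is_weak_deriv_def
      by (intro exI[of _ "bump 1 (a - 1) (b + 1)"]) auto
  qed
  have lf: "locally_integrable f"
  proof (rule locally_integrable_if_bump_mult[OF mf])
    fix a b :: real assume "a < b"
    \<comment> \<open>For \<open>f\<close> only the weights \<open>deriv \<phi>\<close> are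
      available, and these have mean zero. So a translated copy of the bump is subtracted;
      \<open>c\<close> is the length of \<open>(a - 1, b + 1)\<close>, hence the copy lives to the
      right of \<open>b + 1\<close> and does not disturb positivity on
      \<open>[a, b]\<close>.\<close>
    define c where "c = b + 2 - a"
    define h where "h x = bump 1 (a - 1) (b + 1) x - 1 * bump 1 (a - 1 + c) (b + 1 + c) x" for x
    have t0: "test_fun (bump 1 p q)" for p q by (rule test_fun_bump) simp
    have th: "test_fun h"
      unfolding h_def by (intro test_fun_lincomb t0)
    have "(\<integral>x. bump 1 (a - 1 + c) (b + 1 + c) x \<partial>lborel) = (\<integral>x. bump 1 (a - 1 + c) (b + 1 + c) (c + 1 * x) \<partial>lborel)"
      by (subst lborel_integral_real_affine[of 1 _ c]) auto
    also have "\<dots> = (\<integral>x. bump 1 (a - 1) (b + 1) x \<partial>lborel)" by (simp add: bump_def algebra_simps)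
    finally have "(\<integral>x. h x \<partial>lborel) = 0"
      unfolding h_def using test_fun_integrable[OF t0] by simp
    then obtain \<phi> where \<phi>: "test_fun \<phi>" "deriv \<phi> = h" using test_fun_antideriv[OF th] by blast
    have "h x > 0" if "x \<in> {a..b}" for x
      using that bump_pos[of x "a - 1" "b + 1" 1] by (auto simp: h_def bump_eq_0 c_def)
    then show "\<exists>\<phi>. continuous_on UNIV \<phi> \<and> (\<forall>x\<in>{a..b}. \<phi> x > 0) \<and> integrable lborel (\<lambda>x. f x * \<phi> x)"
      using wd \<phi> test_fun_continuous(1)[OF th] unfolding is_weak_deriv_def by (intro exI[of _ h]) auto
  qed
  obtain F where F: "antideriv F g" using antideriv_exists[OF lg] by blast
  have wF: "is_weak_deriv F g" using F by (rule antideriv_weak_deriv)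
  have "locally_integrable (\<lambda>x. f x - F x)"
    by (intro locally_integrable_diff lf locally_integrable_continuous antideriv_continuous[OF F])
  moreover have "(\<integral>x. (f x - F x) * deriv \<phi> x \<partial>lborel) = 0" if "test_fun \<phi>" for \<phi>
    using wd wF that by (simp add: is_weak_deriv_def left_diff_distrib)
  ultimately obtain c where c: "AE x in lborel. f x - F x = c" by (rule AE_const_if_weak_deriv_zero)
  have "antideriv (\<lambda>x. F x + c) (\<lambda>x. g x + 0)"
    by (intro antideriv_add F) (auto simp: antideriv_def locally_integrable_def)
  moreover have "AE x in lborel. f x = F x + c" using c by eventually_elim simp
  ultimately show ?thesis using that[of "\<lambda>x. F x + c"] by simp
qed

section \<open>Uniqueness of weak derivatives and the chosen representative\<close>

lemma weak_deriv_unique: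
  assumes "is_weak_deriv f g1" "is_weak_deriv f g2" "f \<in> borel_measurable borel"
  shows "AE x in lborel. g1 x = g2 x"
proof -
  have "locally_integrable g" if "is_weak_deriv f g" for g
    using antideriv_locally_integrable by (rule weak_deriv_antideriv[OF that assms(3)])
  then have "locally_integrable g1" "locally_integrable g2"
    using assms(1,2) by auto
  then have "AE x in lborel. g1 x - g2 x = 0"
  proof (intro AE_zero_if_test_integrals_zero locally_integrable_diff)
    fix \<phi> assume "test_fun \<phi>"
    then show "(\<integral>x. (g1 x - g2 x) * \<phi> x \<partial>lborel) = 0"
      using assms(1,2) unfolding is_weak_deriv_def by (simp add: left_diff_distrib)
  qed
  then show ?thesis by simp
qed

lemma is_weak_deriv_cong_AE:
  assumes "AE x in lborel. f x = f' x" "is_weak_deriv f g" 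
    "f \<in> borel_measurable borel" "f' \<in> borel_measurable borel"
  shows "is_weak_deriv f' g"
proof -
  note [measurable] = assms(3,4)
  have "integrable lborel (\<lambda>x. f' x * deriv \<phi> x) \<and>
    (\<integral>x. f' x * deriv \<phi> x \<partial>lborel) = (\<integral>x. f x * deriv \<phi> x \<partial>lborel)" if t: "test_fun \<phi>" for \<phi>
  proof -
    have [measurable]: "deriv \<phi> \<in> borel_measurable borel"
      using test_fun_continuous(2)[OF t] by (rule borel_measurable_continuous_onI)
    have ae: "AE x in lborel. f x * deriv \<phi> x = f' x * deriv \<phi> x" using assms(1) by eventually_elim simp
    have "integrable lborel (\<lambda>x. f x * deriv \<phi> x)" using assms(2) t by (simp add: is_weak_deriv_def)
    then have "integrable lborel (\<lambda>x. f' x * deriv \<phi> x)"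
      by (subst integrable_cong_AE[OF _ _ ae, symmetric]) auto
    moreover have "(\<integral>x. f' x * deriv \<phi> x \<partial>lborel) = (\<integral>x. f x * deriv \<phi> x \<partial>lborel)"
      by (rule integral_cong_AE[OF _ _ ae, symmetric]) measurable
    ultimately show ?thesis by simp
  qed
  then show ?thesis using assms(2) by (simp add: is_weak_deriv_def)
qed

lemma wderiv_weak_deriv: "is_weak_deriv f g \<Longrightarrow> is_weak_deriv f (wderiv f)"
  unfolding wderiv_def by (rule someI[of "is_weak_deriv f"])

text \<open>The choice operator leaves \<open>wderiv f\<close> undetermined on null sets; this is
  the most that can be said about it, and it suffices for integrals.\<close>

lemma wderiv_AE:
  assumes "is_weak_deriv f g" "f \<in> borel_measurable borel"
  shows "AE x in lborel. wderiv f x = g x"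
  by (rule weak_deriv_unique[OF wderiv_weak_deriv[OF assms(1)] assms])

text \<open>The rule by which \<open>wderiv\<close> is computed from here on: any primitive that
  agrees with \<open>f\<close> almost everywhere reveals it. The measurability clause is what later
  replacements under the integral sign require.\<close>

lemma wderiv_antideriv:
  assumes F: "antideriv F g" and "AE x in lborel. f x = F x" "f \<in> borel_measurable borel"
  shows "is_weak_deriv f g" "AE x in lborel. wderiv f x = g x" "wderiv f \<in> borel_measurable borel"
proof -
  have [measurable]: "F \<in> borel_measurable borel" 
    by (rule antideriv_measurable[OF F])
  have "AE x in lborel. F x = f x" using assms(2) by eventually_elim simp
  then show w: "is_weak_deriv f g" using assms(3)
    by (rule is_weak_deriv_cong_AE[OF _ antideriv_weak_deriv[OF F] \<open>F \<in> borel_measurable borel\<close>])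
  then show "AE x in lborel. wderiv f x = g x" using assms(3) by (rule wderiv_AE)
  show "wderiv f \<in> borel_measurable borel"
    using wderiv_weak_deriv[OF w] by (simp add: is_weak_deriv_def)
qed

section \<open>Weak convergence in $L^2$\<close>

lemma L2_measurable: "L2 f \<Longrightarrow> f \<in> borel_measurable borel"
  unfolding L2_def by simp

lemma L2_square_integrable: "L2 f \<Longrightarrow> integrable lborel (\<lambda>x. (f x)\<^sup>2)"
  unfolding L2_def by simp

lemma L2_mult_integrable:
  assumes "L2 f" "L2 g" shows "integrable lborel (\<lambda>x. f x * g x)"
proof -
  note [measurable] = L2_measurable[OF assms(1)] L2_measurable[OF assms(2)]
  have "\<bar>f x * g x\<bar> \<le> (f x)\<^sup>2 + (g x)\<^sup>2" for x
    using sum_squares_bound[of "\<bar>f x\<bar>" "\<bar>g x\<bar>", unfolded mult.assoc power2_abs]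
      mult_nonneg_nonneg[OF abs_ge_zero abs_ge_zero, of "f x" "g x"]
    unfolding abs_mult by linarith
  then show ?thesis
    by (intro Bochner_Integration.integrable_bound[OF Bochner_Integration.integrable_add[OF L2_square_integrable L2_square_integrable, OF assms]])
      auto
qed

lemma L2_cmult: "L2 f \<Longrightarrow> L2 (\<lambda>x. c * f x)"
  unfolding L2_def by (auto simp: power_mult_distrib)

lemma L2_add:
  assumes "L2 f" "L2 g" shows "L2 (\<lambda>x. f x + g x)"
proof -
  have "integrable lborel (\<lambda>x. (f x)\<^sup>2 + (g x)\<^sup>2 + 2 * (f x * g x))"
    using assms L2_square_integrable L2_mult_integrable by auto
  then show ?thesis
    using assms unfolding L2_def by (auto simp: power2_sum mult.assoc)
qed

lemma L2_diff: "L2 f \<Longrightarrow> L2 g \<Longrightarrow> L2 (\<lambda>x. f x - g x)"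
  using L2_add[of f "\<lambda>x. (-1) * g x"] L2_cmult[of g "-1"] by simp

lemma L2_bound:
  assumes "L2 f" "g \<in> borel_measurable borel" "AE x in lborel. \<bar>g x\<bar> \<le> \<bar>f x\<bar>"
  shows "L2 g"
  unfolding L2_def
proof
  note [measurable] = assms(2)
  show "integrable lborel (\<lambda>x. (g x)\<^sup>2)"
    by (rule Bochner_Integration.integrable_bound[OF L2_square_integrable[OF assms(1)]])
      (use assms(3) in \<open>auto elim!: eventually_mono simp: abs_le_square_iff\<close>)
qed (use assms in simp)

lemma L2_cong_AE: "L2 f \<Longrightarrow> g \<in> borel_measurable borel \<Longrightarrow> AE x in lborel. g x = f x \<Longrightarrow> L2 g"
  by (rule L2_bound) (auto elim!: eventually_mono)

lemma L2_indicator_bounded: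
  assumes "A \<in> sets borel" shows "L2 (indicator (A \<inter> {-R<..<R}))"
proof -
  have "emeasure lborel (A \<inter> {-R<..<R}) \<le> emeasure lborel {-\<bar>R\<bar>..\<bar>R\<bar>}"
    by (rule emeasure_mono) auto
  also have "\<dots> < \<infinity>" by (simp add: emeasure_lborel_Icc_eq)
  finally have "integrable lborel (indicator (A \<inter> {-R<..<R}) :: real \<Rightarrow> real)"
    using assms by (intro integrable_real_indicator) auto
  moreover have "(indicator (A \<inter> {-R<..<R}) x :: real)\<^sup>2 = indicator (A \<inter> {-R<..<R}) x" for x
    by (simp add: indicator_def)
  ultimately show ?thesis using assms unfolding L2_def by simp
qed

text \<open>The integral of \<open>(t f + g)^2\<close> is a nonnegative quadratic polynomial in
  \<open>t\<close>; its value at the minimizer \<open>- B / A\<close> is the claim.\<close>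

lemma Cauchy_Schwarz_L2:
  assumes "L2 f" "L2 g"
  shows "(\<integral>x. f x * g x \<partial>lborel)\<^sup>2 \<le> (\<integral>x. (f x)\<^sup>2 \<partial>lborel) * (\<integral>x. (g x)\<^sup>2 \<partial>lborel)"
proof -
  define A where "A = (\<integral>x. (f x)\<^sup>2 \<partial>lborel)"
  define B where "B = (\<integral>x. f x * g x \<partial>lborel)"
  define D where "D = (\<integral>x. (g x)\<^sup>2 \<partial>lborel)"
  have i: "integrable lborel (\<lambda>x. (f x)\<^sup>2)" "integrable lborel (\<lambda>x. (g x)\<^sup>2)" "integrable lborel (\<lambda>x. f x * g x)"
    using assms L2_square_integrable L2_mult_integrable by auto
  have q: "0 \<le> t\<^sup>2 * A + 2 * t * B + D" for t
  proof -
    have "0 \<le> (\<integral>x. (t * f x + g x)\<^sup>2 \<partial>lborel)" by simp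
    also have "\<dots> = (\<integral>x. t\<^sup>2 * (f x)\<^sup>2 + (2 * t) * (f x * g x) + (g x)\<^sup>2 \<partial>lborel)"
      by (simp add: power2_sum power_mult_distrib algebra_simps)
    also have "\<dots> = t\<^sup>2 * A + 2 * t * B + D"
      using i by (simp add: A_def B_def D_def)
    finally show ?thesis .
  qed
  have "A \<ge> 0" unfolding A_def by simp
  have "B\<^sup>2 \<le> A * D"
  proof (cases "A = 0")
    case True
    have "B = 0"
    proof (rule ccontr)
      assume "B \<noteq> 0"
      \<comment> \<open>With \<open>A = 0\<close> the polynomial is affine, and this
        \<open>t\<close> makes it equal to -1.\<close>
      then show False using q[of "- (D + 1) / (2 * B)"] True by (simp add: field_simps)
    qed
    then show ?thesis using True by simp
  next
    case False
    then have "A > 0" using \<open>A \<ge> 0\<close> by simp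
    have "0 \<le> A * ((- B / A)\<^sup>2 * A + 2 * (- B / A) * B + D)"
      using q[of "- B / A"] \<open>A \<ge> 0\<close> by (rule mult_nonneg_nonneg[rotated])
    also have "\<dots> = A * D - B\<^sup>2"
      using \<open>A > 0\<close> by (simp add: field_simps power2_eq_square)
    finally show ?thesis by simp
  qed
  then show ?thesis unfolding A_def B_def D_def .
qed

lemma Cauchy_Schwarz_L2_sqrt:
  assumes "L2 f" "L2 g" "(\<integral>x. (f x)\<^sup>2 \<partial>lborel) \<le> C"
  shows "\<bar>\<integral>x. f x * g x \<partial>lborel\<bar> \<le> sqrt (C * (\<integral>x. (g x)\<^sup>2 \<partial>lborel))"
proof (rule real_le_rsqrt)
  have "(\<integral>x. f x * g x \<partial>lborel)\<^sup>2 \<le> (\<integral>x. (f x)\<^sup>2 \<partial>lborel) * (\<integral>x. (g x)\<^sup>2 \<partial>lborel)"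
    by (rule Cauchy_Schwarz_L2[OF assms(1,2)])
  also have "\<dots> \<le> C * (\<integral>x. (g x)\<^sup>2 \<partial>lborel)"
    using assms(3) by (rule mult_right_mono) simp
  finally show "\<bar>\<integral>x. f x * g x \<partial>lborel\<bar>\<^sup>2 \<le> C * (\<integral>x. (g x)\<^sup>2 \<partial>lborel)" by simp
qed

text \<open>Since the \<open>k n\<close> are bounded in L^2, Cauchy-Schwarz estimates the pairing
  with \<open>h - s j\<close> uniformly in \<open>n\<close>. Hence the functions \<open>h\<close>
  whose pairings tend to 0 form a closed set, and it is enough to test on a dense class.\<close>

lemma weak_null_closed:
  assumes k: "\<And>n. L2 (k n)" "\<And>n. (\<integral>x. (k n x)\<^sup>2 \<partial>lborel) \<le> C"
    and s: "\<And>j. L2 (s j)" "L2 h" "(\<lambda>j::nat. \<integral>x. (h x - s j x)\<^sup>2 \<partial>lborel) \<longlonglongrightarrow> 0"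
    and lim: "\<And>j. (\<lambda>n::nat. \<integral>x. k n x * s j x \<partial>lborel) \<longlonglongrightarrow> 0"
  shows "(\<lambda>n. \<integral>x. k n x * h x \<partial>lborel) \<longlonglongrightarrow> 0"
proof (rule LIMSEQ_I)
  fix e :: real assume "e > 0"
  have "(\<lambda>j. sqrt (C * (\<integral>x. (h x - s j x)\<^sup>2 \<partial>lborel))) \<longlonglongrightarrow> sqrt (C * 0)"
    by (intro tendsto_intros s)
  then have "\<forall>\<^sub>F j in sequentially. sqrt (C * (\<integral>x. (h x - s j x)\<^sup>2 \<partial>lborel)) < e / 2"
    using \<open>e > 0\<close> by (intro order_tendstoD(2)) auto
  then obtain j where j: "sqrt (C * (\<integral>x. (h x - s j x)\<^sup>2 \<partial>lborel)) < e / 2"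
    using eventually_happens trivial_limit_sequentially by blast
  obtain N where N: "\<And>n. n \<ge> N \<Longrightarrow> \<bar>\<integral>x. k n x * s j x \<partial>lborel\<bar> < e / 2"
    using LIMSEQ_D[OF lim[of j], of "e / 2"] \<open>e > 0\<close> by auto
  have "\<bar>\<integral>x. k n x * h x \<partial>lborel\<bar> < e" if "n \<ge> N" for n
  proof -
    have "(\<integral>x. k n x * h x \<partial>lborel) = (\<integral>x. k n x * s j x + k n x * (h x - s j x) \<partial>lborel)"
      by (simp add: algebra_simps)
    also have "\<dots> = (\<integral>x. k n x * s j x \<partial>lborel) + (\<integral>x. k n x * (h x - s j x) \<partial>lborel)"
      by (intro Bochner_Integration.integral_add L2_mult_integrable L2_diff k s)
    finally show ?thesis
      using N[OF that] Cauchy_Schwarz_L2_sqrt[OF k(1) L2_diff[OF s(2) s(1)] k(2), of n j] j by linarith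
  qed
  then show "\<exists>N. \<forall>n\<ge>N. norm ((\<integral>x. k n x * h x \<partial>lborel) - 0) < e" by auto
qed

text \<open>Again a Dynkin argument. Cutting with \<open>(-R, R)\<close> keeps all indicators in
  L^2, and for disjoint unions the partial sums converge there, so \<open>weak_null_closed\<close>
  applies.\<close>

lemma weak_null_indicator:
  assumes k: "\<And>n. L2 (k n)" "\<And>n. (\<integral>x. (k n x)\<^sup>2 \<partial>lborel) \<le> C"
    and ivl: "\<And>a b. (\<lambda>n::nat. \<integral>x. k n x * indicator {a<..<b} x \<partial>lborel) \<longlonglongrightarrow> 0"
    and "A \<in> sets borel"
  shows "(\<lambda>n. \<integral>x. k n x * indicator (A \<inter> {-R<..<R}) x \<partial>lborel) \<longlonglongrightarrow> 0"
  using \<open>A \<in> sets borel\<close>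
proof (induction rule: borel_interval_induct)
  case (interval a b)
  then show ?case using ivl by (simp add: Int_greaterThanLessThan)
next
  case (compl A)
  have "(\<integral>x. k n x * indicator (- A \<inter> {-R<..<R}) x \<partial>lborel) =
    (\<integral>x. k n x * indicator {-R<..<R} x \<partial>lborel) - (\<integral>x. k n x * indicator (A \<inter> {-R<..<R}) x \<partial>lborel)" for n
  proof (subst Bochner_Integration.integral_diff[symmetric])
    show "integrable lborel (\<lambda>x. k n x * indicator (A \<inter> {-R<..<R}) x)"
      by (rule L2_mult_integrable[OF k(1) L2_indicator_bounded[OF compl(1)]])
    show "integrable lborel (\<lambda>x. k n x * indicator {-R<..<R} x)"
      using L2_mult_integrable[OF k(1) L2_indicator_bounded[of UNIV]] by simp
  qed (auto intro!: Bochner_Integration.integral_cong simp: indicator_def)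
  moreover have "(\<lambda>n. (\<integral>x. k n x * indicator {-R<..<R} x \<partial>lborel) - (\<integral>x. k n x * indicator (A \<inter> {-R<..<R}) x \<partial>lborel)) \<longlonglongrightarrow> 0 - 0"
    by (intro tendsto_diff ivl compl)
  ultimately show ?case by simp
next
  case (union A)
  let ?I = "{-R<..<R}"
  define s where "s j x = (\<Sum>i<j. indicator (A i \<inter> ?I) x :: real)" for j :: nat and x
  have s_eq: "s j x = indicator ((\<Union>i<j. A i) \<inter> ?I) x" for j x
  proof -
    have "s j x = indicator (\<Union>i<j. A i \<inter> ?I) x"
      unfolding s_def using union(1)
      by (intro indicator_UN_disjoint[symmetric]) (auto simp: disjoint_family_on_def)
    also have "(\<Union>i<j. A i \<inter> ?I) = (\<Union>i<j. A i) \<inter> ?I" by blast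
    finally show ?thesis .
  qed
  have [measurable]: "A i \<in> sets borel" for i using union(2) by auto
  show ?case
  proof (rule weak_null_closed[OF k, where s = s])
    show "L2 (s j)" for j
      unfolding s_eq by (intro L2_indicator_bounded) measurable
    show "L2 (indicator ((\<Union>i. A i) \<inter> ?I))"
      by (intro L2_indicator_bounded) measurable
    show "(\<lambda>n. \<integral>x. k n x * s j x \<partial>lborel) \<longlonglongrightarrow> 0" for j
    proof -
      have "(\<integral>x. k n x * s j x \<partial>lborel) = (\<Sum>i<j. \<integral>x. k n x * indicator (A i \<inter> ?I) x \<partial>lborel)" for n
        unfolding s_def sum_distrib_left
        by (intro Bochner_Integration.integral_sum L2_mult_integrable k L2_indicator_bounded) measurable
      moreover have "(\<lambda>n. \<Sum>i<j. \<integral>x. k n x * indicator (A i \<inter> ?I) x \<partial>lborel) \<longlonglongrightarrow> (\<Sum>i<j. 0)"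
        by (intro tendsto_sum union)
      ultimately show ?thesis by simp
    qed
    have "(\<lambda>j. \<integral>x. (indicator ((\<Union>i. A i) \<inter> ?I) x - s j x)\<^sup>2 \<partial>lborel) \<longlonglongrightarrow> (\<integral>x. 0 \<partial>(lborel :: real measure))"
    proof (rule integral_dominated_convergence[where w = "indicator {-R..R}"])
      show "integrable lborel (indicator {-R..R} :: real \<Rightarrow> real)" by (simp add: emeasure_lborel_Icc_eq)
      show "AE x in lborel. norm ((indicator ((\<Union>i. A i) \<inter> ?I) x - s j x)\<^sup>2) \<le> (indicator {-R..R} x :: real)" for j
        by (auto simp: s_eq indicator_def)
      show "AE x in lborel. (\<lambda>j. (indicator ((\<Union>i. A i) \<inter> ?I) x - s j x)\<^sup>2) \<longlonglongrightarrow> 0"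
      proof (intro AE_I2)
        fix x
        show "(\<lambda>j. (indicator ((\<Union>i. A i) \<inter> ?I) x - s j x)\<^sup>2) \<longlonglongrightarrow> 0"
        proof (cases "\<exists>i. x \<in> A i")
          case True
          then obtain i where i: "x \<in> A i" by blast
          have "\<forall>\<^sub>F j in sequentially. (indicator ((\<Union>i. A i) \<inter> ?I) x - s j x)\<^sup>2 = 0"
            using eventually_gt_at_top[of i] by eventually_elim (use i in \<open>auto simp: s_eq indicator_def\<close>)
          then show ?thesis by (rule tendsto_eventually)
        qed (auto simp: s_eq indicator_def)
      qed
    qed (auto simp: s_eq)
    then show "(\<lambda>j. \<integral>x. (indicator ((\<Union>i. A i) \<inter> ?I) x - s j x)\<^sup>2 \<partial>lborel) \<longlonglongrightarrow> 0" by simp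
  qed
qed simp

text \<open>Simple functions cut off to \<open>(-j, j)\<close> are finite combinations of the
  indicators just treated, and they approximate \<open>h\<close> in L^2.\<close>

lemma weak_null_L2:
  assumes k: "\<And>n. L2 (k n)" "\<And>n. (\<integral>x. (k n x)\<^sup>2 \<partial>lborel) \<le> C"
    and ivl: "\<And>a b. (\<lambda>n::nat. \<integral>x. k n x * indicator {a<..<b} x \<partial>lborel) \<longlonglongrightarrow> 0"
    and h: "L2 h"
  shows "(\<lambda>n. \<integral>x. k n x * h x \<partial>lborel) \<longlonglongrightarrow> 0"
proof -
  have [measurable]: "h \<in> borel_measurable borel" using h by (rule L2_measurable)
  obtain F where F: "\<And>i. simple_function lborel (F i)" "\<And>x. (\<lambda>i. F i x) \<longlonglongrightarrow> h x" "\<And>i x. \<bar>F i x\<bar> \<le> 2 * \<bar>h x\<bar>"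
    using borel_measurable_implies_sequence_metric[of h lborel 0] by auto
  have [measurable]: "F i \<in> borel_measurable borel" for i
    using borel_measurable_simple_function[OF F(1)] by simp
  define s where "s j x = F j x * indicator {- real j<..<real j} x" for j x
  have [measurable]: "s j \<in> borel_measurable borel" for j unfolding s_def by measurable
  have sb: "\<bar>s j x\<bar> \<le> 2 * \<bar>h x\<bar>" for j x
    using F(3)[of j x] by (auto simp: s_def indicator_def)
  show ?thesis
  proof (rule weak_null_closed[OF k _ h])
    show "L2 (s j)" for j
      by (rule L2_bound[OF L2_cmult[OF h, of 2]]) (auto simp: sb abs_mult)
    have "(\<lambda>j. \<integral>x. (h x - s j x)\<^sup>2 \<partial>lborel) \<longlonglongrightarrow> (\<integral>x. 0 \<partial>(lborel :: real measure))"
    \<comment> \<open>The simple functions are bounded by \<open>2 |h|\<close>, so the error is at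
      most \<open>3 |h|\<close>; its square gives the 9.\<close>
    proof (rule integral_dominated_convergence[where w = "\<lambda>x. 9 * (h x)\<^sup>2"])
      show "integrable lborel (\<lambda>x. 9 * (h x)\<^sup>2)" using L2_square_integrable[OF h] by simp
      have "(h x - s j x)\<^sup>2 \<le> 9 * (h x)\<^sup>2" for x j
      proof -
        have "\<bar>h x - s j x\<bar> \<le> \<bar>3 * h x\<bar>" using sb[of j x] by simp
        then have "(h x - s j x)\<^sup>2 \<le> (3 * h x)\<^sup>2" by (simp add: abs_le_square_iff)
        then show ?thesis by (simp add: power_mult_distrib)
      qed
      then show "AE x in lborel. norm ((h x - s j x)\<^sup>2) \<le> 9 * (h x)\<^sup>2" for j by simp
      have "(\<lambda>j. s j x) \<longlonglongrightarrow> h x" for x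
      proof (rule Lim_transform_eventually[OF F(2)])
        obtain N where N: "\<bar>x\<bar> < real N" using reals_Archimedean2 by blast
        show "\<forall>\<^sub>F j in sequentially. F j x = s j x"
          using eventually_ge_at_top[of N] by eventually_elim (use N in \<open>auto simp: s_def indicator_def\<close>)
      qed
      then have "(\<lambda>j. (h x - s j x)\<^sup>2) \<longlonglongrightarrow> (h x - h x)\<^sup>2" for x
        by (intro tendsto_intros)
      then show "AE x in lborel. (\<lambda>j. (h x - s j x)\<^sup>2) \<longlonglongrightarrow> 0" by simp
    qed measurable
    then show "(\<lambda>j. \<integral>x. (h x - s j x)\<^sup>2 \<partial>lborel) \<longlonglongrightarrow> 0" by simp
    fix j
    let ?B = "\<lambda>y. F j -` {y} \<inter> {- real j<..<real j}"
    have fin: "finite (range (F j))" using simple_functionD(1)[OF F(1)] by simp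
    have [measurable]: "F j -` {y} \<in> sets borel" for y
      using simple_functionD(2)[OF F(1), of j "{y}"] by simp
    have s_eq: "s j x = (\<Sum>y\<in>range (F j). y * indicator (?B y) x)" for x
    proof -
      have "F j x = (\<Sum>y\<in>range (F j). indicator (F j -` {y}) x * y)"
        using simple_function_indicator_representation_banach[OF F(1), of x j]
        by (simp only: space_lborel space_borel Int_UNIV_right real_scaleR_def UNIV_I)
      then have "s j x = (\<Sum>y\<in>range (F j). indicator (F j -` {y}) x * y) * indicator {- real j<..<real j} x"
        unfolding s_def by (rule arg_cong)
      also have "\<dots> = (\<Sum>y\<in>range (F j). y * indicator (?B y) x)"
        unfolding sum_distrib_right by (intro sum.cong refl) (simp add: indicator_def)
      finally show ?thesis .
    qed
    have "(\<integral>x. k n x * s j x \<partial>lborel) = (\<Sum>y\<in>range (F j). y * (\<integral>x. k n x * indicator (?B y) x \<partial>lborel))" for n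
    proof -
      have "(\<integral>x. k n x * s j x \<partial>lborel) = (\<integral>x. (\<Sum>y\<in>range (F j). y * (k n x * indicator (?B y) x)) \<partial>lborel)"
        by (simp add: s_eq sum_distrib_left mult.left_commute)
      also have "\<dots> = (\<Sum>y\<in>range (F j). \<integral>x. y * (k n x * indicator (?B y) x) \<partial>lborel)"
        by (intro Bochner_Integration.integral_sum integrable_mult_right L2_mult_integrable k L2_indicator_bounded) measurable
      finally show ?thesis by simp
    qed
    moreover have "(\<lambda>n. \<Sum>y\<in>range (F j). y * (\<integral>x. k n x * indicator (?B y) x \<partial>lborel)) \<longlonglongrightarrow> (\<Sum>y\<in>range (F j). y * 0)"
      by (intro tendsto_sum tendsto_mult tendsto_const weak_null_indicator[OF k ivl]) measurable
    ultimately show "(\<lambda>n. \<integral>x. k n x * s j x \<partial>lborel) \<longlonglongrightarrow> 0" by simp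
  qed
qed

section \<open>Point evaluation on $H^1$\<close>

lemma H1E:
  assumes "H1 f"
  obtains F where "antideriv F (wderiv f)" "AE x in lborel. f x = F x" "L2 F" "L2 (wderiv f)" "L2 f"
proof -
  obtain g where g: "is_weak_deriv f g" "L2 g" and f: "L2 f" using assms unfolding H1_def by blast
  have w: "is_weak_deriv f (wderiv f)" using g(1) by (rule wderiv_weak_deriv)
  obtain F where F: "antideriv F (wderiv f)" "AE x in lborel. f x = F x"
    by (rule weak_deriv_antideriv[OF w L2_measurable[OF f]])
  have "L2 (wderiv f)"
    by (rule L2_cong_AE[OF g(2) _ wderiv_AE[OF g(1) L2_measurable[OF f]]])
      (use w in \<open>simp add: is_weak_deriv_def\<close>)
  moreover have "L2 F"
    by (rule L2_cong_AE[OF f antideriv_measurable[OF F(1)]])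
      (use F(2) in \<open>auto elim!: eventually_mono\<close>)
  ultimately show ?thesis using F f that by blast
qed

lemma H1I:
  assumes "antideriv F g" "AE x in lborel. f x = F x" "f \<in> borel_measurable borel" "L2 F" "L2 g"
  shows "H1 f"
  using wderiv_antideriv(1)[OF assms(1-3)] L2_cong_AE[OF assms(4,3,2)] assms(5)
  unfolding H1_def by blast

text \<open>The fundamental theorem with finitely many exceptional points per bounded interval. It
  serves both the kink of the kernel and the interpolants, whose nodes are infinitely many but
  locally finite.\<close>

lemma antideriv_piecewise:
  assumes cont: "continuous_on UNIV F" and lf: "locally_integrable f"
    and d: "\<And>a b. \<exists>S. finite S \<and> (\<forall>x\<in>{a<..<b} - S. (F has_real_derivative f x) (at x))"
  shows "antideriv F f"
  unfolding antideriv_def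
proof (intro conjI allI impI lf)
  fix a b :: real assume "a \<le> b"
  obtain S where S: "finite S" "\<And>x. x \<in> {a<..<b} - S \<Longrightarrow> (F has_real_derivative f x) (at x)"
    using d[of a b] by blast
  have "(f has_integral (F b - F a)) {a..b}"
    using S \<open>a \<le> b\<close> continuous_on_subset[OF cont]
    by (intro fundamental_theorem_of_calculus_interior_strong[of S])
      (auto simp: has_real_derivative_iff_has_vector_derivative)
  then have "F b - F a = integral {a..b} f" by (simp add: integral_unique)
  also have "\<dots> = (\<integral>x. indicator {a..b} x * f x \<partial>lborel)"
    using set_borel_integral_eq_integral(2)[of "{a..b}" f] locally_integrableD[OF lf, of a b]
    by (simp add: set_integrable_def set_lebesgue_integral_def)
  finally show "F b - F a = (\<integral>x. indicator {a..b} x * f x \<partial>lborel)" .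
qed

text \<open>Cauchy-Schwarz against the indicator of \<open>[a, b]\<close>. Keeping only the energy
  inside the interval is essential for summing over cells later.\<close>

lemma antideriv_Holder_local:
  assumes F: "antideriv F g" and "L2 g" "a \<le> b"
  shows "\<bar>F b - F a\<bar> \<le> sqrt ((b - a) * (\<integral>x. indicator {a..b} x * (g x)\<^sup>2 \<partial>lborel))"
proof -
  let ?I = "indicator {a..b} :: real \<Rightarrow> real"
  have sq: "(?I x)\<^sup>2 = ?I x" for x by (simp add: indicator_def)
  have "L2 ?I"
    unfolding L2_def sq using \<open>a \<le> b\<close> by (auto intro!: integrable_real_indicator)
  moreover have "L2 (\<lambda>x. ?I x * g x)"
    using L2_measurable[OF \<open>L2 g\<close>] by (intro L2_bound[OF \<open>L2 g\<close>]) (auto simp: indicator_def)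
  moreover have "(\<integral>x. (?I x)\<^sup>2 \<partial>lborel) \<le> b - a"
    unfolding sq using \<open>a \<le> b\<close> by simp
  ultimately have "\<bar>\<integral>x. ?I x * (?I x * g x) \<partial>lborel\<bar> \<le> sqrt ((b - a) * (\<integral>x. (?I x * g x)\<^sup>2 \<partial>lborel))"
    by (rule Cauchy_Schwarz_L2_sqrt)
  moreover have "?I x * (?I x * g x) = ?I x * g x" "(?I x * g x)\<^sup>2 = ?I x * (g x)\<^sup>2" for x
    by (simp_all add: indicator_def)
  ultimately show ?thesis unfolding antiderivD[OF F \<open>a \<le> b\<close>] by simp
qed

lemma antideriv_Holder:
  assumes F: "antideriv F g" and "L2 g" "a \<le> b"
  shows "\<bar>F b - F a\<bar> \<le> sqrt ((b - a) * (\<integral>x. (g x)\<^sup>2 \<partial>lborel))"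
proof -
  note [measurable] = L2_measurable[OF \<open>L2 g\<close>]
  have "(\<integral>x. indicator {a..b} x * (g x)\<^sup>2 \<partial>lborel) \<le> (\<integral>x. (g x)\<^sup>2 \<partial>lborel)"
    using L2_square_integrable[OF \<open>L2 g\<close>]
    by (intro integral_mono Bochner_Integration.integrable_bound[OF L2_square_integrable[OF \<open>L2 g\<close>]])
      (auto simp: indicator_def)
  then show ?thesis
    using antideriv_Holder_local[OF assms] \<open>a \<le> b\<close>
    by (meson diff_ge_0_iff_ge mult_left_mono order_trans real_sqrt_le_mono)
qed

text \<open>The fundamental solution of $f - f''$, which represents point evaluation on $H^1$.\<close>
definition green_kernel :: "real \<Rightarrow> real \<Rightarrow> real" where
  "green_kernel x y = exp (- \<bar>y - x\<bar>) / 2"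

text \<open>The derivative in the second argument. At the kink \<open>y = x\<close> it takes the
  value 0 through \<open>sgn\<close>, which no integral sees.\<close>

definition green_kernel' :: "real \<Rightarrow> real \<Rightarrow> real" where
  "green_kernel' x y = sgn (x - y) * (exp (- \<bar>y - x\<bar>) / 2)"

lemma green_kernel_continuous: "continuous_on UNIV (green_kernel x)"
  unfolding green_kernel_def by (intro continuous_intros) auto

lemma green_kernel_measurable[measurable]: "green_kernel x \<in> borel_measurable borel" "green_kernel' x \<in> borel_measurable borel"
  unfolding green_kernel_def green_kernel'_def by measurable

lemma integrable_exp_abs: "integrable lborel (\<lambda>t::real. exp (- \<bar>t - x\<bar>))"
proof -
  have pos: "integrable lborel (\<lambda>t::real. exp (- t) * indicator {0..} t)"
  proof (rule integrableI_bounded)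
    have "(\<integral>\<^sup>+ t. ennreal (norm (exp (- t) * indicator {0..} t)) \<partial>(lborel :: real measure)) =
      (\<integral>\<^sup>+ t. ennreal (exp (- t)) * indicator {0..} t \<partial>lborel)"
      by (intro nn_integral_cong) (auto simp: indicator_def)
    also have "\<dots> = ennreal (0 - (- exp (- 0)))"
    proof (rule nn_integral_FTC_atLeast[where F = "\<lambda>t. - exp (- t)"])
      show "((\<lambda>t::real. - exp (- t)) \<longlongrightarrow> 0) at_top" by real_asymp
    qed (auto intro!: derivative_eq_intros)
    finally show "(\<integral>\<^sup>+ t. ennreal (norm (exp (- t) * indicator {0..} t)) \<partial>(lborel :: real measure)) < \<infinity>" by simp
  qed measurable
  then have "integrable lborel (\<lambda>t::real. exp (- (0 + (-1) * t)) * indicator {0..} (0 + (-1) * t))"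
    by (subst lborel_integrable_real_affine_iff) auto
  with pos have "integrable lborel (\<lambda>t::real. exp (- t) * indicator {0..} t + exp (- (0 + (-1) * t)) * indicator {0..} (0 + (-1) * t))"
    by (rule Bochner_Integration.integrable_add)
  then have "integrable lborel (\<lambda>t::real. exp (- \<bar>t\<bar>))"
    by (rule Bochner_Integration.integrable_bound) (auto simp: indicator_def)
  then have "integrable lborel (\<lambda>t::real. exp (- \<bar>- x + 1 * t\<bar>))"
    by (subst lborel_integrable_real_affine_iff) auto
  then show ?thesis by (simp add: algebra_simps)
qed

lemma L2_kernel: "L2 (green_kernel x)" "L2 (green_kernel' x)"
proof -
  have "(green_kernel x y)\<^sup>2 \<le> exp (- \<bar>y - x\<bar>)" for y
  proof -
    have "(green_kernel x y)\<^sup>2 = exp (- \<bar>y - x\<bar>) * (exp (- \<bar>y - x\<bar>) / 4)"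
      by (simp add: green_kernel_def power2_eq_square)
    also have "\<dots> \<le> exp (- \<bar>y - x\<bar>) * 1"
      by (intro mult_left_mono) (auto intro: order_trans[of _ 1])
    finally show ?thesis by simp
  qed
  then show *: "L2 (green_kernel x)"
    unfolding L2_def by (auto intro!: Bochner_Integration.integrable_bound[OF integrable_exp_abs[of x]])
  show "L2 (green_kernel' x)"
    by (rule L2_bound[OF *]) (auto simp: green_kernel_def green_kernel'_def abs_mult sgn_real_def)
qed

lemma antideriv_kernel: "antideriv (green_kernel x) (green_kernel' x)"
proof (rule antideriv_piecewise[OF green_kernel_continuous])
  show "locally_integrable (green_kernel' x)"
    unfolding locally_integrable_def
    by (auto intro!: Bochner_Integration.integrable_bound[OF integrable_exp_abs[of x]]
      simp: green_kernel'_def indicator_def abs_mult sgn_real_def)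
  fix a b
  have "(green_kernel x has_real_derivative green_kernel' x y) (at y)" if "y \<noteq> x" for y
  proof (cases "y < x")
    case True
    have "((\<lambda>y. exp (y - x) / 2) has_real_derivative green_kernel' x y) (at y)"
      using True by (auto intro!: derivative_eq_intros simp: green_kernel'_def)
    then show ?thesis
      by (rule DERIV_cong_ev[THEN iffD1, OF refl _ refl, rotated])
        (use True eventually_nhds_in_open[of "{..<x}" y] in \<open>auto simp: green_kernel_def elim!: eventually_mono\<close>)
  next
    case False
    have "((\<lambda>y. exp (x - y) / 2) has_real_derivative green_kernel' x y) (at y)"
      using False that by (auto intro!: derivative_eq_intros simp: green_kernel'_def)
    then show ?thesis
      by (rule DERIV_cong_ev[THEN iffD1, OF refl _ refl, rotated])
        (use False that eventually_nhds_in_open[of "{x<..}" y] in \<open>auto simp: green_kernel_def elim!: eventually_mono\<close>)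
  qed
  then show "\<exists>S. finite S \<and> (\<forall>y\<in>{a<..<b} - S. (green_kernel x has_real_derivative green_kernel' x y) (at y))"
    by (intro exI[of _ "{x}"]) auto
qed

lemma H1_kernel: "H1 (green_kernel x)"
  by (rule H1I[OF antideriv_kernel _ _ L2_kernel]) auto

lemma antideriv_exp_decay:
  assumes F: "antideriv F g" and "L2 g"
  shows "(\<lambda>n. F (x + real n) * exp (- real n)) \<longlonglongrightarrow> 0" "(\<lambda>n. F (x - real n) * exp (- real n)) \<longlonglongrightarrow> 0"
proof -
  let ?D = "\<integral>x. (g x)\<^sup>2 \<partial>lborel"
  define B where "B n = (\<bar>F x\<bar> + sqrt (real n * ?D)) * exp (- real n)" for n
  have "(\<lambda>n. exp (- real n)) \<longlonglongrightarrow> 0" "(\<lambda>n. sqrt (real n) * exp (- real n)) \<longlonglongrightarrow> 0"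
    by real_asymp+
  then have "(\<lambda>n. \<bar>F x\<bar> * exp (- real n) + sqrt ?D * (sqrt (real n) * exp (- real n))) \<longlonglongrightarrow> \<bar>F x\<bar> * 0 + sqrt ?D * 0"
    by (intro tendsto_intros)
  then have B: "B \<longlonglongrightarrow> 0" unfolding B_def by (simp add: real_sqrt_mult algebra_simps)
  have "\<bar>F (x + real n)\<bar> \<le> \<bar>F x\<bar> + sqrt (real n * ?D)" "\<bar>F (x - real n)\<bar> \<le> \<bar>F x\<bar> + sqrt (real n * ?D)" for n
    using antideriv_Holder[OF assms, of x "x + real n"] antideriv_Holder[OF assms, of "x - real n" x] by auto
  then have "\<bar>F (x + real n) * exp (- real n)\<bar> \<le> B n" "\<bar>F (x - real n) * exp (- real n)\<bar> \<le> B n" for n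
    unfolding B_def abs_mult by (auto intro!: mult_mono)
  then show "(\<lambda>n. F (x + real n) * exp (- real n)) \<longlonglongrightarrow> 0" "(\<lambda>n. F (x - real n) * exp (- real n)) \<longlonglongrightarrow> 0"
    using B by (auto intro!: Lim_null_comparison[OF _ B])
qed

text \<open>Off \<open>x\<close> the kernel equals its own second derivative, so on either side the
  integrand is the derivative of \<open>F\<close> times \<open>green_kernel' x\<close>. That factor
  drops from 1/2 to -1/2 across \<open>x\<close>, and each side contributes
  \<open>F x / 2\<close>.\<close>

lemma kernel_reproducing:
  assumes F: "antideriv F g" and L: "L2 F" "L2 g"
  shows "(\<integral>y. F y * green_kernel x y \<partial>lborel) + (\<integral>y. g y * green_kernel' x y \<partial>lborel) = F x"
proof -
  define k where "k y = F y * green_kernel x y + g y * green_kernel' x y" for y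
  have i: "integrable lborel (\<lambda>y. F y * green_kernel x y)" "integrable lborel (\<lambda>y. g y * green_kernel' x y)"
    using L L2_kernel L2_mult_integrable by auto
  then have ik: "integrable lborel k" unfolding k_def by simp
  note [measurable] = borel_measurable_integrable[OF ik, simplified] L2_measurable[OF L(1)] L2_measurable[OF L(2)]
  have indk: "integrable lborel (\<lambda>y. indicator {a..b} y * k y)" for a b
    by (rule Bochner_Integration.integrable_bound[OF ik]) (auto simp: indicator_def)
  have a1: "antideriv (\<lambda>y. F y * (exp (y - x) / 2)) (\<lambda>y. F y * (exp (y - x) / 2) + g y * (exp (y - x) / 2))"
    by (rule antideriv_by_parts[OF F]) (auto intro!: derivative_eq_intros continuous_intros)
  have a2: "antideriv (\<lambda>y. F y * (- exp (x - y) / 2)) (\<lambda>y. F y * (exp (x - y) / 2) + g y * (- exp (x - y) / 2))"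
    by (rule antideriv_by_parts[OF F]) (auto intro!: derivative_eq_intros continuous_intros)
  have 1: "(\<integral>y. indicator {x - real n..x} y * k y \<partial>lborel) = F x / 2 - F (x - real n) * exp (- real n) / 2" for n
  proof -
    have "(\<integral>y. indicator {x - real n..x} y * k y \<partial>lborel) =
      (\<integral>y. indicator {x - real n..x} y * (F y * (exp (y - x) / 2) + g y * (exp (y - x) / 2)) \<partial>lborel)"
    proof (rule integral_cong_AE)
      show "AE y in lborel. indicator {x - real n..x} y * k y =
        indicator {x - real n..x} y * (F y * (exp (y - x) / 2) + g y * (exp (y - x) / 2))"
        using AE_lborel_singleton[of x] by (rule eventually_mono)
          (auto simp: indicator_def k_def green_kernel_def green_kernel'_def)
    qed measurable
    also have "\<dots> = F x * (exp (x - x) / 2) - F (x - real n) * (exp (x - real n - x) / 2)"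
      by (rule antiderivD[OF a1, symmetric]) simp
    finally show ?thesis by simp
  qed
  have 2: "(\<integral>y. indicator {x..x + real n} y * k y \<partial>lborel) = F x / 2 - F (x + real n) * exp (- real n) / 2" for n
  proof -
    have "(\<integral>y. indicator {x..x + real n} y * k y \<partial>lborel) =
      (\<integral>y. indicator {x..x + real n} y * (F y * (exp (x - y) / 2) + g y * (- exp (x - y) / 2)) \<partial>lborel)"
    proof (rule integral_cong_AE)
      show "AE y in lborel. indicator {x..x + real n} y * k y =
        indicator {x..x + real n} y * (F y * (exp (x - y) / 2) + g y * (- exp (x - y) / 2))"
        using AE_lborel_singleton[of x] by (rule eventually_mono)
          (auto simp: indicator_def k_def green_kernel_def green_kernel'_def)
    qed measurable
    also have "\<dots> = F (x + real n) * (- exp (x - (x + real n)) / 2) - F x * (- exp (x - x) / 2)"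
      by (rule antiderivD[OF a2, symmetric]) simp
    finally show ?thesis by simp
  qed
  \<comment> \<open>The two closed intervals share the point \<open>x\<close>, where
    \<open>k\<close> is counted twice: hence the dominating function \<open>2 |k|\<close> and the
    exclusion of one point from the limit.\<close>
  have "(\<lambda>n. \<integral>y. indicator {x - real n..x} y * k y + indicator {x..x + real n} y * k y \<partial>lborel) \<longlonglongrightarrow> (\<integral>y. k y \<partial>lborel)"
  proof (rule integral_dominated_convergence[where w = "\<lambda>y. 2 * \<bar>k y\<bar>"])
    show "integrable lborel (\<lambda>y. 2 * \<bar>k y\<bar>)" using ik by simp
    show "AE y in lborel. norm (indicator {x - real n..x} y * k y + indicator {x..x + real n} y * k y) \<le> 2 * \<bar>k y\<bar>" for n
      by (auto simp: indicator_def)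
    show "AE y in lborel. (\<lambda>n. indicator {x - real n..x} y * k y + indicator {x..x + real n} y * k y) \<longlonglongrightarrow> k y"
      using AE_lborel_singleton[of x]
    proof (rule eventually_mono)
      fix y assume "y \<noteq> x"
      obtain N where N: "\<bar>y - x\<bar> < real N" using reals_Archimedean2 by blast
      have "\<forall>\<^sub>F n in sequentially. indicator {x - real n..x} y * k y + indicator {x..x + real n} y * k y = k y"
        using eventually_ge_at_top[of N] by (rule eventually_mono) (use N \<open>y \<noteq> x\<close> in \<open>auto simp: indicator_def\<close>)
      then show "(\<lambda>n. indicator {x - real n..x} y * k y + indicator {x..x + real n} y * k y) \<longlonglongrightarrow> k y"
        by (rule tendsto_eventually)
    qed
  qed measurable
  moreover have "(\<integral>y. indicator {x - real n..x} y * k y + indicator {x..x + real n} y * k y \<partial>lborel) =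
    F x / 2 - F (x - real n) * exp (- real n) / 2 + (F x / 2 - F (x + real n) * exp (- real n) / 2)" for n
    unfolding 1[symmetric] 2[symmetric] by (rule Bochner_Integration.integral_add[OF indk indk])
  moreover have "(\<lambda>n. F x / 2 - F (x - real n) * exp (- real n) / 2 + (F x / 2 - F (x + real n) * exp (- real n) / 2))
    \<longlonglongrightarrow> F x / 2 - 0 / 2 + (F x / 2 - 0 / 2)"
    by (intro tendsto_intros antideriv_exp_decay[OF F L(2)]) auto
  ultimately have "(\<integral>y. k y \<partial>lborel) = F x"
    using LIMSEQ_unique by fastforce
  then show ?thesis unfolding k_def using i by simp
qed

lemma H1_inner_kernel:
  assumes f: "H1 f" and F: "antideriv F (wderiv f)" "AE x in lborel. f x = F x"
  shows "H1_inner f (green_kernel x) = F x"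
proof -
  obtain L: "L2 (wderiv f)" "L2 f" using f by (rule H1E)
  have mF: "F \<in> borel_measurable borel"
    by (rule antideriv_measurable[OF F(1)])
  note [measurable] = L2_measurable[OF L(1)] L2_measurable[OF L(2)] mF
  have LF: "L2 F" by (rule L2_cong_AE[OF L(2) mF]) (use F(2) in \<open>auto elim!: eventually_mono\<close>)
  have w: "AE y in lborel. wderiv (green_kernel x) y = green_kernel' x y" and [measurable]: "wderiv (green_kernel x) \<in> borel_measurable borel"
    using wderiv_antideriv(2,3)[OF antideriv_kernel[of x], of "green_kernel x"] by auto
  have "(\<integral>y. f y * green_kernel x y \<partial>lborel) = (\<integral>y. F y * green_kernel x y \<partial>lborel)"
    by (rule integral_cong_AE) (use F(2) in \<open>auto elim!: eventually_mono\<close>)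
  moreover have "(\<integral>y. wderiv f y * wderiv (green_kernel x) y \<partial>lborel) = (\<integral>y. wderiv f y * green_kernel' x y \<partial>lborel)"
    by (rule integral_cong_AE) (use w in \<open>auto elim!: eventually_mono\<close>)
  ultimately show ?thesis
    unfolding H1_inner_def using kernel_reproducing[OF F(1) LF L(1)] by simp
qed

section \<open>The lower bound\<close>

lemma antideriv_open_interval:
  assumes F: "antideriv F g" and "a \<le> b"
  shows "(\<integral>x. g x * indicator {a<..<b} x \<partial>lborel) = F b - F a"
proof -
  note [measurable] = locally_integrable_measurable[OF antideriv_locally_integrable[OF F]]
  have "(\<integral>x. g x * indicator {a<..<b} x \<partial>lborel) = (\<integral>x. indicator {a..b} x * g x \<partial>lborel)"
  proof (rule integral_cong_AE)
    show "AE x in lborel. g x * indicator {a<..<b} x = indicator {a..b} x * g x"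
      using AE_lborel_singleton[of a] AE_lborel_singleton[of b]
      by eventually_elim (auto simp: indicator_def)
  qed measurable
  then show ?thesis using antiderivD[OF assms] by simp
qed

text \<open>The pairings with intervals are increments of \<open>F n\<close>, so pointwise
  convergence of primitives plus an L^2 bound on the densities is enough. It is applied to the lower
  bound and again to the slopes of the interpolants.\<close>

lemma weak_null_antideriv:
  assumes F: "\<And>n. antideriv (F n) (k n)" "\<And>x. (\<lambda>n::nat. F n x) \<longlonglongrightarrow> 0"
    and k: "\<And>n. L2 (k n)" "\<And>n. (\<integral>x. (k n x)\<^sup>2 \<partial>lborel) \<le> C" and h: "L2 h"
  shows "(\<lambda>n. \<integral>x. k n x * h x \<partial>lborel) \<longlonglongrightarrow> 0"
proof (rule weak_null_L2[OF k _ h])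
  fix a b :: real
  show "(\<lambda>n. \<integral>x. k n x * indicator {a<..<b} x \<partial>lborel) \<longlonglongrightarrow> 0"
  proof (cases "a \<le> b")
    case True
    have "(\<lambda>n. F n b - F n a) \<longlonglongrightarrow> 0 - 0" by (intro tendsto_diff F)
    then show ?thesis by (simp add: antideriv_open_interval[OF F(1) True])
  qed simp
qed

section \<open>Semicontinuity of the Dirichlet integral\<close>

lemma L2_diff_square_le:
  assumes "L2 f" "L2 g"
  shows "(\<integral>x. (f x - g x)\<^sup>2 \<partial>lborel) \<le> 2 * (\<integral>x. (f x)\<^sup>2 \<partial>lborel) + 2 * (\<integral>x. (g x)\<^sup>2 \<partial>lborel)"
proof -
  have "(\<integral>x. (f x - g x)\<^sup>2 \<partial>lborel) \<le> (\<integral>x. 2 * (f x)\<^sup>2 + 2 * (g x)\<^sup>2 \<partial>lborel)"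
  proof (rule integral_mono)
    show "(f x - g x)\<^sup>2 \<le> 2 * (f x)\<^sup>2 + 2 * (g x)\<^sup>2" for x
      using zero_le_power2[of "f x + g x"] by (simp add: power2_eq_square algebra_simps)
  qed (use assms L2_square_integrable L2_diff in auto)
  then show ?thesis using assms L2_square_integrable by simp
qed

lemma liminf_add_ennreal:
  fixes a b :: "nat \<Rightarrow> ennreal"
  shows "liminf a + liminf b \<le> liminf (\<lambda>n. a n + b n)"
proof (rule LIMSEQ_le)
  have lim: "(\<lambda>n. INF m\<in>{n..}. c m) \<longlonglongrightarrow> liminf c" for c :: "nat \<Rightarrow> ennreal"
    unfolding liminf_SUP_INF by (intro LIMSEQ_SUP monoI INF_superset_mono) auto
  show "(\<lambda>n. (INF m\<in>{n..}. a m) + (INF m\<in>{n..}. b m)) \<longlonglongrightarrow> liminf a + liminf b"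
    by (intro tendsto_add lim)
  show "(\<lambda>n. INF m\<in>{n..}. a m + b m) \<longlonglongrightarrow> liminf (\<lambda>n. a n + b n)" by (rule lim)
  show "\<exists>N. \<forall>n\<ge>N. (INF m\<in>{n..}. a m) + (INF m\<in>{n..}. b m) \<le> (INF m\<in>{n..}. a m + b m)"
    by (intro exI[of _ 0] allI impI INF_greatest add_mono INF_lower) auto
qed

text \<open>No bound on the energies is assumed. If \<open>I n \<le> C < J\<close> held for
  infinitely many \<open>n\<close>, that subsequence would be bounded; its pairings with
  \<open>h\<close> would converge to \<open>J\<close> while Cauchy-Schwarz keeps them below
  \<open>sqrt (C * J)\<close>, which forces \<open>J \<le> C\<close>.\<close>

lemma dirichlet_lower_semicontinuous:
  assumes X: "\<And>n. antideriv (X n) (g n)" "\<And>n. L2 (g n)" and Y: "antideriv Y h" "L2 h"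
    and lim: "\<And>x. (\<lambda>n. X n x) \<longlonglongrightarrow> Y x"
  shows "(\<integral>\<^sup>+x. ennreal ((h x)\<^sup>2) \<partial>lborel) \<le> liminf (\<lambda>n. \<integral>\<^sup>+x. ennreal ((g n x)\<^sup>2) \<partial>lborel)"
proof -
  define I where "I n = (\<integral>x. (g n x)\<^sup>2 \<partial>lborel)" for n
  define J where "J = (\<integral>x. (h x)\<^sup>2 \<partial>lborel)"
  have I0: "I n \<ge> 0" for n unfolding I_def by simp
  have nn: "(\<integral>\<^sup>+x. ennreal ((f x)\<^sup>2) \<partial>lborel) = ennreal (\<integral>x. (f x)\<^sup>2 \<partial>lborel)" if "L2 f" for f
    using L2_square_integrable[OF that] by (rule nn_integral_eq_integral) simp
  have ev: "\<forall>\<^sub>F n in sequentially. C < I n" if "C < J" for C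
  proof (rule ccontr)
    assume "\<not> ?thesis"
    then have "\<exists>\<^sub>F n in sequentially. I n \<le> C" by (simp add: frequently_def not_le)
    then have inf: "infinite {n. I n \<le> C}" by (simp add: frequently_sequentially infinite_nat_iff_unbounded_le)
    define r where "r = enumerate {n. I n \<le> C}"
    have r: "strict_mono r" unfolding r_def by (rule strict_mono_enumerate[OF inf])
    have Ir: "I (r n) \<le> C" for n
      using enumerate_in_set[OF inf, of n] unfolding r_def by simp
    then have "C \<ge> 0" using I0 order_trans by blast
    have "(\<lambda>n. \<integral>x. (g (r n) x - h x) * h x \<partial>lborel) \<longlonglongrightarrow> 0"
    proof (rule weak_null_antideriv[where F = "\<lambda>n x. X (r n) x - Y x" and C = "2 * C + 2 * J"])
      show "antideriv (\<lambda>x. X (r n) x - Y x) (\<lambda>x. g (r n) x - h x)" for n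
        by (intro antideriv_diff X Y)
      show "L2 (\<lambda>x. g (r n) x - h x)" for n by (intro L2_diff X Y)
      show "(\<integral>x. (g (r n) x - h x)\<^sup>2 \<partial>lborel) \<le> 2 * C + 2 * J" for n
        using L2_diff_square_le[OF X(2) Y(2), of "r n"] Ir[of n] unfolding I_def J_def by linarith
      show "(\<lambda>n. X (r n) x - Y x) \<longlonglongrightarrow> 0" for x
        using LIMSEQ_subseq_LIMSEQ[OF lim r, of x] by (simp add: o_def LIM_zero)
    qed (rule Y)
    moreover have "(\<integral>x. (g (r n) x - h x) * h x \<partial>lborel) = (\<integral>x. g (r n) x * h x \<partial>lborel) - J" for n
      using L2_mult_integrable[OF X(2) Y(2), of "r n"] L2_square_integrable[OF Y(2)]
      by (simp add: left_diff_distrib J_def power2_eq_square)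
    ultimately have "(\<lambda>n. \<integral>x. g (r n) x * h x \<partial>lborel) \<longlonglongrightarrow> J"
      by (simp add: LIM_zero_iff)
    moreover have "(\<integral>x. g (r n) x * h x \<partial>lborel) \<le> sqrt (C * J)" for n
      using Cauchy_Schwarz_L2_sqrt[OF X(2) Y(2) Ir[of n, unfolded I_def]] unfolding J_def by linarith
    ultimately have "J \<le> sqrt (C * J)" by (intro LIMSEQ_le_const2) auto
    then have "J\<^sup>2 \<le> C * J"
      using \<open>C \<ge> 0\<close> that by (simp add: real_le_rsqrt sqrt_ge_absD)
    then show False using that \<open>C \<ge> 0\<close> by (simp add: power2_eq_square)
  qed
  \<comment> \<open>Only values strictly below \<open>J\<close> are reached this way;
    \<open>J\<close> itself follows by letting \<open>C\<close> increase to it.\<close>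
  have "ennreal C \<le> liminf (\<lambda>n. ennreal (I n))" if "C < J" for C
    by (rule Liminf_bounded[OF eventually_mono[OF ev[OF that]]]) (simp add: ennreal_leI)
  then have "ennreal J \<le> liminf (\<lambda>n. ennreal (I n))"
    using tendsto_upperbound[of ennreal "ennreal J" "at_left J" "liminf (\<lambda>n. ennreal (I n))"]
    by (auto simp: eventually_at_filter intro!: tendsto_intros)
  then show ?thesis using nn X Y unfolding I_def J_def by simp
qed

text \<open>Everything later needed about an admissible function, expressed through its continuous
  representative. Measurability of \<xi> is recovered from that of \<open>\<xi> - v\<close>, as
  \<open>v\<close> is continuous; the last clause turns point values of \<open>X\<close> into
  quantities that weak convergence controls.\<close>

lemma adm_repr:
  assumes "\<xi> \<in> adm v" and v: "antideriv v v'" "L2 v'"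
  obtains X g where "antideriv X g" "L2 g" "AE x in lborel. \<xi> x = X x" "AE x in lborel. wderiv \<xi> x = g x"
    "AE x in lborel. wderiv (\<lambda>x. \<xi> x - v x) x = g x - v' x" "L2 (\<lambda>x. X x - v x)" 
    "\<xi> \<in> borel_measurable borel" "\<And>x. H1_inner (\<lambda>x. \<xi> x - v x) (green_kernel x) = X x - v x"
proof -
  let ?f = "\<lambda>x. \<xi> x - v x"
  have H: "H1 ?f" using assms(1) unfolding adm_def by simp
  obtain F where F: "antideriv F (wderiv ?f)" "AE x in lborel. ?f x = F x" "L2 F" "L2 (wderiv ?f)" "L2 ?f"
    using H by (rule H1E)
  have mv[measurable]: "v \<in> borel_measurable borel"
    by (rule antideriv_measurable[OF v(1)])
  have "(\<lambda>x. ?f x + v x) \<in> borel_measurable borel" using L2_measurable[OF F(5)] by measurable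
  then have m: "\<xi> \<in> borel_measurable borel" by simp
  have X: "antideriv (\<lambda>x. F x + v x) (\<lambda>x. wderiv ?f x + v' x)" by (intro antideriv_add F v)
  have ae: "AE x in lborel. \<xi> x = F x + v x" using F(2) by eventually_elim simp
  show ?thesis
    by (rule that[OF X L2_add[OF F(4) v(2)] ae wderiv_antideriv(2)[OF X ae m] _ _ m])
      (use F(3) H1_inner_kernel[OF H F(1,2)] in auto)
qed

lemma Fen_repr:
  assumes "AE x in lborel. \<xi> x = X x" "AE x in lborel. wderiv \<xi> x = g x"
  shows "Fen w \<xi> = (\<integral>\<^sup>+x. ennreal ((g x)\<^sup>2) \<partial>lborel) + (\<integral>\<^sup>+x. ennreal (w (X x)) \<partial>lborel)"
proof -
  have "(\<integral>\<^sup>+x. ennreal ((wderiv \<xi> x)\<^sup>2) \<partial>lborel) = (\<integral>\<^sup>+x. ennreal ((g x)\<^sup>2) \<partial>lborel)"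
    by (rule nn_integral_cong_AE) (use assms(2) in \<open>auto elim!: eventually_mono\<close>)
  moreover have "(\<integral>\<^sup>+x. ennreal (w (\<xi> x)) \<partial>lborel) = (\<integral>\<^sup>+x. ennreal (w (X x)) \<partial>lborel)"
    by (rule nn_integral_cong_AE) (use assms(1) in \<open>auto elim!: eventually_mono\<close>)
  ultimately show ?thesis unfolding Fen_def by simp
qed

lemma Fen_lower_semicontinuous:
  assumes v: "antideriv v v'" "L2 v'" and w: "continuous_on UNIV w"
    and \<xi>: "\<xi> \<in> adm v" "\<And>n. xs n \<in> adm v" "weak_conv_A v xs \<xi>"
  shows "Fen w \<xi> \<le> liminf (\<lambda>n. Fen w (xs n))"
proof -
  obtain Y h where Y: "antideriv Y h" "L2 h" "AE x in lborel. \<xi> x = Y x" "AE x in lborel. wderiv \<xi> x = h x"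
    "\<And>x. H1_inner (\<lambda>x. \<xi> x - v x) (green_kernel x) = Y x - v x"
    by (rule adm_repr[OF \<xi>(1) v]) (rule that)
  \<comment> \<open>Packing the properties into one predicate on pairs allows representatives to be
    chosen for all \<open>n\<close> at once.\<close>
  define repr where "repr n P \<longleftrightarrow> antideriv (fst P) (snd P) \<and> L2 (snd P) \<and> (AE x in lborel. xs n x = fst P x)
    \<and> (AE x in lborel. wderiv (xs n) x = snd P x)
    \<and> (\<forall>x. H1_inner (\<lambda>x. xs n x - v x) (green_kernel x) = fst P x - v x)" for n P
  have "\<exists>P. repr n P" for n
  proof (rule adm_repr[OF \<xi>(2)[of n] v])
    fix X g assume "antideriv X g" "L2 g" "AE x in lborel. xs n x = X x" "AE x in lborel. wderiv (xs n) x = g x"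
      "\<And>x. H1_inner (\<lambda>x. xs n x - v x) (green_kernel x) = X x - v x"
    then have "repr n (X, g)" unfolding repr_def by simp
    then show ?thesis by blast
  qed
  then obtain P where P: "\<And>n. repr n (P n)" by metis
  define X g where "X n = fst (P n)" and "g n = snd (P n)" for n
  have X: "\<And>n. antideriv (X n) (g n)" "\<And>n. L2 (g n)" "\<And>n. AE x in lborel. xs n x = X n x"
    "\<And>n. AE x in lborel. wderiv (xs n) x = g n x"
    "\<And>n x. H1_inner (\<lambda>x. xs n x - v x) (green_kernel x) = X n x - v x"
    using P unfolding repr_def X_def g_def by auto
  have lim: "(\<lambda>n. X n x) \<longlonglongrightarrow> Y x" for x
  proof -
    have "(\<lambda>n. X n x - v x) \<longlonglongrightarrow> Y x - v x"
      using \<xi>(3) H1_kernel[of x] unfolding weak_conv_A_def X(5)[symmetric] Y(5)[symmetric] by blast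
    from tendsto_add[OF this tendsto_const[of "v x"]] show ?thesis by simp
  qed
  have [measurable]: "X n \<in> borel_measurable borel" "w \<in> borel_measurable borel" for n
    using antideriv_continuous[OF X(1)] w by (auto intro: borel_measurable_continuous_onI)
  have "(\<lambda>n. ennreal (w (X n x))) \<longlonglongrightarrow> ennreal (w (Y x))" for x
    using w lim by (intro tendsto_ennrealI isCont_tendsto_compose[of _ w]) (auto simp: continuous_on_eq_continuous_at)
  then have "(\<integral>\<^sup>+x. ennreal (w (Y x)) \<partial>lborel) = (\<integral>\<^sup>+x. liminf (\<lambda>n. ennreal (w (X n x))) \<partial>lborel)"
    by (intro nn_integral_cong lim_imp_Liminf[symmetric]) auto
  also have "\<dots> \<le> liminf (\<lambda>n. \<integral>\<^sup>+x. ennreal (w (X n x)) \<partial>lborel)"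
    by (intro nn_integral_liminf) measurable
  finally have "Fen w \<xi> \<le> liminf (\<lambda>n. \<integral>\<^sup>+x. ennreal ((g n x)\<^sup>2) \<partial>lborel) + liminf (\<lambda>n. \<integral>\<^sup>+x. ennreal (w (X n x)) \<partial>lborel)"
    unfolding Fen_repr[OF Y(3,4)]
    by (intro add_mono dirichlet_lower_semicontinuous[OF X(1,2) Y(1,2) lim])
  also have "\<dots> \<le> liminf (\<lambda>n. Fen w (xs n))"
    unfolding Fen_repr[OF X(3,4)] by (rule liminf_add_ennreal)
  finally show ?thesis .
qed

text \<open>Restricting to the grid only raises the energy, so the lower bound is insensitive to
  \<delta>.\<close>

lemma Fen_le_Eden: "Fen w \<xi> \<le> Eden w v \<delta> \<xi>"
  unfolding Eden_def by simp

section \<open>Piecewise affine interpolation\<close>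

lemma L2_locally_integrable:
  assumes "L2 f" shows "locally_integrable f"
  unfolding locally_integrable_def
proof (intro allI)
  fix a b :: real
  have sq: "(indicator {a..b} x :: real)\<^sup>2 = indicator {a..b} x" for x by (simp add: indicator_def)
  have "L2 (indicator {a..b})"
    unfolding L2_def sq by (auto intro!: integrable_real_indicator simp: emeasure_lborel_Icc_eq)
  then show "integrable lborel (\<lambda>x. indicator {a..b} x * f x)" using assms by (rule L2_mult_integrable)
qed

lemma L2_nn_integral_bound:
  assumes [measurable]: "f \<in> borel_measurable borel"
    and "(\<integral>\<^sup>+x. ennreal ((f x)\<^sup>2) \<partial>lborel) \<le> ennreal C" "C \<ge> 0"
  shows "L2 f" "(\<integral>x. (f x)\<^sup>2 \<partial>lborel) \<le> C"
proof -
  have i: "integrable lborel (\<lambda>x. (f x)\<^sup>2)"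
    using assms by (intro integrableI_bounded) (auto intro: le_less_trans)
  then show "L2 f" unfolding L2_def by simp
  show "(\<integral>x. (f x)\<^sup>2 \<partial>lborel) \<le> C"
    using assms(2,3) nn_integral_eq_integral[OF i] by simp
qed

text \<open>The left node of the cell containing \<open>x\<close>. Cells are half-open, a node
  belonging to the cell on its right. Describing slope, interpolant and energy by functions of
  \<open>x\<close> makes sums over cells into plain integrals.\<close>

definition grid :: "real \<Rightarrow> real \<Rightarrow> real" where
  "grid d x = of_int \<lfloor>x / d\<rfloor> * d"

definition grid_slope :: "real \<Rightarrow> (real \<Rightarrow> real) \<Rightarrow> real \<Rightarrow> real" where
  "grid_slope d X x = (X (grid d x + d) - X (grid d x)) / d"

definition grid_interpolant :: "real \<Rightarrow> (real \<Rightarrow> real) \<Rightarrow> real \<Rightarrow> real" where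
  "grid_interpolant d X x = X (grid d x) + (x - grid d x) * grid_slope d X x"

definition cell_energy :: "real \<Rightarrow> (real \<Rightarrow> real) \<Rightarrow> real \<Rightarrow> real" where
  "cell_energy d g x = (\<integral>t. indicator {grid d x..grid d x + d} t * (g t)\<^sup>2 \<partial>lborel)"

lemma floor_cell_iff: "d > 0 \<Longrightarrow> \<lfloor>x / d\<rfloor> = i \<longleftrightarrow> x \<in> {of_int i * d..<(of_int i + 1) * d}"
  by (auto simp: floor_eq_iff field_simps)

lemma grid_bounds: "d > 0 \<Longrightarrow> grid d x \<le> x" "d > 0 \<Longrightarrow> x < grid d x + d"
  using floor_cell_iff[of d x "\<lfloor>x / d\<rfloor>"] by (auto simp: grid_def distrib_right)

lemma grid_measurable[measurable]: "grid d \<in> borel_measurable borel"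
  unfolding grid_def by measurable

lemma grid_interpolant_affine:
  assumes "d > 0" "x \<in> {of_int i * d..(of_int i + 1) * d}"
  shows "grid_interpolant d X x = X (of_int i * d) + (x - of_int i * d) * ((X ((of_int i + 1) * d) - X (of_int i * d)) / d)"
proof (cases "x = (of_int i + 1) * d")
  \<comment> \<open>At the right end of the cell \<open>grid\<close> already switches to the next
    cell; both affine formulas give the nodal value there, which is why the formula holds on closed
    cells.\<close>
  case True
  have d: "d \<noteq> 0" using assms(1) by simp
  then have "grid d x = x" using True by (simp add: grid_def)
  moreover have "x - of_int i * d = d" unfolding True by (simp add: algebra_simps)
  ultimately show ?thesis using d by (simp add: grid_interpolant_def True[symmetric])
next
  case False
  then have "\<lfloor>x / d\<rfloor> = i" using assms by (simp add: floor_cell_iff)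
  then have "grid d x = of_int i * d" by (simp add: grid_def)
  then show ?thesis by (simp add: grid_interpolant_def grid_slope_def algebra_simps)
qed

lemma grid_interpolant_continuous:
  assumes "d > 0" shows "continuous_on UNIV (grid_interpolant d X)"
proof -
  have seg: "continuous_on {of_int i * d..(of_int i + 1) * d} (grid_interpolant d X)" for i
    by (subst continuous_on_cong[OF refl grid_interpolant_affine[OF assms]]) (use assms in \<open>auto intro!: continuous_intros\<close>)
  have "isCont (grid_interpolant d X) x" for x
  proof -
    define i where "i = \<lfloor>x / d\<rfloor>"
    \<comment> \<open>If \<open>x\<close> is a node, it is an endpoint of its own cell; joining the
      cell on the left puts it in the interior.\<close>
    have "continuous_on ({of_int (i - 1) * d..(of_int (i - 1) + 1) * d} \<union> {of_int i * d..(of_int i + 1) * d}) (grid_interpolant d X)"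
      by (intro continuous_on_closed_Un seg) auto
    also have "{of_int (i - 1) * d..(of_int (i - 1) + 1) * d} \<union> {of_int i * d..(of_int i + 1) * d} =
      {(of_int i - 1) * d..(of_int i + 1) * d}"
      using assms by (auto simp: algebra_simps)
    finally have "continuous_on {(of_int i - 1) * d..(of_int i + 1) * d} (grid_interpolant d X)" .
    moreover have "x \<in> interior {(of_int i - 1) * d..(of_int i + 1) * d}"
      using grid_bounds[OF assms, of x] assms by (auto simp: grid_def i_def[symmetric] algebra_simps)
    ultimately show ?thesis by (rule continuous_on_interior)
  qed
  then show ?thesis by (simp add: continuous_at_imp_continuous_on)
qed

lemma grid_interpolant_deriv:
  assumes "d > 0" "x / d \<notin> \<int>"
  shows "(grid_interpolant d X has_real_derivative grid_slope d X x) (at x)"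
proof -
  define i where "i = \<lfloor>x / d\<rfloor>"
  have "x \<noteq> of_int i * d" using assms by auto
  then have x: "x \<in> {of_int i * d<..<(of_int i + 1) * d}"
    using floor_cell_iff[OF assms(1), of x i] by (auto simp: i_def[symmetric])
  have slope: "grid_slope d X x = (X ((of_int i + 1) * d) - X (of_int i * d)) / d"
    by (simp add: grid_slope_def grid_def i_def[symmetric] distrib_right)
  have "((\<lambda>x. X (of_int i * d) + (x - of_int i * d) * ((X ((of_int i + 1) * d) - X (of_int i * d)) / d))
    has_real_derivative grid_slope d X x) (at x)"
    unfolding slope by (rule derivative_eq_intros refl)+ simp
  moreover have "\<forall>\<^sub>F y in nhds x. y \<in> {of_int i * d<..<(of_int i + 1) * d}"
    using x by (intro eventually_nhds_in_open) auto
  then have "\<forall>\<^sub>F y in nhds x. X (of_int i * d) + (y - of_int i * d) * ((X ((of_int i + 1) * d) - X (of_int i * d)) / d)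
    = grid_interpolant d X y"
    by eventually_elim (rule grid_interpolant_affine[OF assms(1), symmetric], auto)
  ultimately show ?thesis
    by (rule DERIV_cong_ev[THEN iffD1, OF refl _ refl, rotated])
qed

lemma antideriv_grid_interpolant:
  assumes "d > 0" "locally_integrable (grid_slope d X)"
  shows "antideriv (grid_interpolant d X) (grid_slope d X)"
proof (rule antideriv_piecewise[OF grid_interpolant_continuous[OF assms(1)] assms(2)])
  fix a b :: real
  let ?S = "(\<lambda>i. of_int i * d) ` {\<lfloor>a / d\<rfloor>..\<lceil>b / d\<rceil>}"
  have "x / d \<notin> \<int>" if "x \<in> {a<..<b} - ?S" for x
  proof
    assume "x / d \<in> \<int>"
    then obtain i where i: "x / d = of_int i" by (auto elim: Ints_cases)
    then have "x = of_int i * d" using assms(1) by (simp add: field_simps)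
    moreover have "a / d \<le> x / d" "x / d \<le> b / d"
      using that assms(1) by (auto intro!: divide_right_mono)
    then have "i \<in> {\<lfloor>a / d\<rfloor>..\<lceil>b / d\<rceil>}" unfolding i by (auto, linarith+)
    ultimately show False using that by blast
  qed
  then show "\<exists>S. finite S \<and> (\<forall>x\<in>{a<..<b} - S. (grid_interpolant d X has_real_derivative grid_slope d X x) (at x))"
    by (intro exI[of _ ?S]) (auto intro!: grid_interpolant_deriv[OF assms(1)])
qed

section \<open>Estimates by the energy of a single cell\<close>

context
  fixes X g :: "real \<Rightarrow> real" and d :: real
  assumes X: "antideriv X g" and g: "L2 g" and d: "d > 0"
begin

lemma square_integrable_indicator: "integrable lborel (\<lambda>t. indicator {a..b} t * (g t)\<^sup>2)"
  using L2_measurable[OF g]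
  by (intro Bochner_Integration.integrable_bound[OF L2_square_integrable[OF g]]) (auto simp: indicator_def)

lemma cell_energy_nonneg: "cell_energy d g x \<ge> 0"
  unfolding cell_energy_def by (rule Bochner_Integration.integral_nonneg) simp

lemma cell_energy_le: "cell_energy d g x \<le> (\<integral>t. (g t)\<^sup>2 \<partial>lborel)"
  unfolding cell_energy_def
  by (intro integral_mono square_integrable_indicator L2_square_integrable[OF g]) (simp add: indicator_def)

text \<open>
  Written with the kernel that tells whether two points share a cell, the sum over all cells
  becomes an application of Tonelli's theorem.
\<close>
lemma nn_integral_cell_energy:
  "(\<integral>\<^sup>+x. ennreal (cell_energy d g x) \<partial>lborel) = ennreal (d * (\<integral>t. (g t)\<^sup>2 \<partial>lborel))"
proof -
  note [measurable] = L2_measurable[OF g]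
  let ?\<chi> = "\<lambda>x t. if \<lfloor>x / d\<rfloor> = \<lfloor>t / d\<rfloor> then 1 else 0 :: ennreal"
  have "ennreal (cell_energy d g x) = (\<integral>\<^sup>+t. ennreal ((g t)\<^sup>2) * ?\<chi> x t \<partial>lborel)" for x
  proof -
    have "ennreal (cell_energy d g x) = (\<integral>\<^sup>+t. ennreal (indicator {grid d x..grid d x + d} t * (g t)\<^sup>2) \<partial>lborel)"
      unfolding cell_energy_def
      by (rule nn_integral_eq_integral[OF square_integrable_indicator, symmetric]) simp
    also have "\<dots> = (\<integral>\<^sup>+t. ennreal ((g t)\<^sup>2) * ?\<chi> x t \<partial>lborel)"
    proof (rule nn_integral_cong_AE)
      \<comment> \<open>The energy is taken over the closed cell, the relation of sharing a cell
        over the half-open one; they differ in the right endpoint only.\<close>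
      show "AE t in lborel. ennreal (indicator {grid d x..grid d x + d} t * (g t)\<^sup>2) = ennreal ((g t)\<^sup>2) * ?\<chi> x t"
        using AE_lborel_singleton[of "grid d x + d"]
      proof (rule eventually_mono)
        fix t assume "t \<noteq> grid d x + d"
        moreover have "\<lfloor>x / d\<rfloor> = \<lfloor>t / d\<rfloor> \<longleftrightarrow> t \<in> {grid d x..<grid d x + d}"
          using floor_cell_iff[OF d, of t "\<lfloor>x / d\<rfloor>"]
          unfolding grid_def distrib_right mult_1_left by metis
        ultimately have "\<lfloor>x / d\<rfloor> = \<lfloor>t / d\<rfloor> \<longleftrightarrow> t \<in> {grid d x..grid d x + d}" by force
        then show "ennreal (indicator {grid d x..grid d x + d} t * (g t)\<^sup>2) = ennreal ((g t)\<^sup>2) * ?\<chi> x t"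
          by (simp only: indicator_def of_bool_def) simp
      qed
    qed measurable
    finally show ?thesis .
  qed
  then have "(\<integral>\<^sup>+x. ennreal (cell_energy d g x) \<partial>lborel) = (\<integral>\<^sup>+x. (\<integral>\<^sup>+t. ennreal ((g t)\<^sup>2) * ?\<chi> x t \<partial>lborel) \<partial>lborel)"
    by simp
  also have "\<dots> = (\<integral>\<^sup>+t. (\<integral>\<^sup>+x. ennreal ((g t)\<^sup>2) * ?\<chi> x t \<partial>lborel) \<partial>lborel)"
    by (rule lborel_pair.Fubini') measurable
  also have "\<dots> = (\<integral>\<^sup>+t. ennreal d * ennreal ((g t)\<^sup>2) \<partial>lborel)"
  proof (rule nn_integral_cong)
    fix t
    \<comment> \<open>For fixed \<open>t\<close> the points sharing its cell form an interval of
      length \<open>d\<close>; this is the factor in the result.\<close>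
    have "(\<integral>\<^sup>+x. ?\<chi> x t \<partial>lborel) = (\<integral>\<^sup>+x. indicator {of_int \<lfloor>t / d\<rfloor> * d..<(of_int \<lfloor>t / d\<rfloor> + 1) * d} x \<partial>lborel)"
      using floor_cell_iff[OF d, of _ "\<lfloor>t / d\<rfloor>"] by (intro nn_integral_cong) (auto simp: indicator_def)
    also have "\<dots> = ennreal d" using d by (simp add: algebra_simps)
    finally show "(\<integral>\<^sup>+x. ennreal ((g t)\<^sup>2) * ?\<chi> x t \<partial>lborel) = ennreal d * ennreal ((g t)\<^sup>2)"
      by (subst nn_integral_cmult) (measurable, simp add: mult.commute)
  qed
  also have "\<dots> = ennreal d * ennreal (\<integral>t. (g t)\<^sup>2 \<partial>lborel)"
    by (subst nn_integral_cmult) (auto simp: nn_integral_eq_integral[OF L2_square_integrable[OF g]])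
  finally show ?thesis using d by (simp add: ennreal_mult)
qed

lemma cell_oscillation:
  assumes "grid d x \<le> y" "y \<le> grid d x + d"
  shows "\<bar>X y - X (grid d x)\<bar> \<le> sqrt (d * cell_energy d g x)"
proof -
  have "(\<integral>t. indicator {grid d x..y} t * (g t)\<^sup>2 \<partial>lborel) \<le> cell_energy d g x"
    unfolding cell_energy_def
    by (intro integral_mono square_integrable_indicator) (use assms in \<open>auto simp: indicator_def\<close>)
  then have "(y - grid d x) * (\<integral>t. indicator {grid d x..y} t * (g t)\<^sup>2 \<partial>lborel) \<le> d * cell_energy d g x"
    using assms d by (intro mult_mono cell_energy_nonneg Bochner_Integration.integral_nonneg) auto
  then show ?thesis
    using antideriv_Holder_local[OF X g assms(1)] real_sqrt_le_mono order_trans by blast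
qed

text \<open>The constant matters: after integration the factor \<open>1 / d\<close> cancels the
  \<open>d\<close> of \<open>nn_integral_cell_energy\<close> exactly, so interpolation does not
  increase the Dirichlet integral, as the limsup inequality demands.\<close>

lemma grid_slope_square_le: "(grid_slope d X x)\<^sup>2 \<le> cell_energy d g x / d"
proof -
  have "\<bar>X (grid d x + d) - X (grid d x)\<bar> \<le> sqrt (d * cell_energy d g x)"
    using d by (intro cell_oscillation) auto
  then have "(X (grid d x + d) - X (grid d x))\<^sup>2 \<le> d * cell_energy d g x"
    using sqrt_ge_absD by blast
  then have "(X (grid d x + d) - X (grid d x))\<^sup>2 / d\<^sup>2 \<le> d * cell_energy d g x / d\<^sup>2"
    by (rule divide_right_mono) simp
  then show ?thesis using d by (simp add: grid_slope_def power_divide power2_eq_square)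
qed

text \<open>Both \<open>X\<close> and its interpolant move away from the common value at the left
  node by at most \<open>sqrt (d * cell_energy d g x)\<close>; squaring the doubled bound gives the
  4.\<close>

lemma grid_interpolant_error: "(grid_interpolant d X x - X x)\<^sup>2 \<le> 4 * d * cell_energy d g x"
proof -
  let ?s = "sqrt (d * cell_energy d g x)"
  have b: "grid d x \<le> x" "x < grid d x + d" using d grid_bounds by auto
  have 1: "\<bar>X x - X (grid d x)\<bar> \<le> ?s" using b by (intro cell_oscillation) auto
  have "\<bar>X (grid d x + d) - X (grid d x)\<bar> \<le> ?s" using d by (intro cell_oscillation) auto
  moreover have "\<bar>(x - grid d x) / d\<bar> \<le> 1" using b d by simp
  ultimately have "\<bar>(x - grid d x) / d\<bar> * \<bar>X (grid d x + d) - X (grid d x)\<bar> \<le> 1 * ?s"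
    by (intro mult_mono) auto
  then have "\<bar>(x - grid d x) * grid_slope d X x\<bar> \<le> ?s"
    by (simp add: grid_slope_def abs_mult)
  with 1 have "\<bar>grid_interpolant d X x - X x\<bar> \<le> 2 * ?s"
    unfolding grid_interpolant_def by linarith
  then have "\<bar>grid_interpolant d X x - X x\<bar>\<^sup>2 \<le> (2 * ?s)\<^sup>2"
    by (rule power_mono) simp
  then have "(grid_interpolant d X x - X x)\<^sup>2 \<le> (2 * ?s)\<^sup>2" by simp
  also have "\<dots> = 4 * d * cell_energy d g x"
    using d cell_energy_nonneg[of x] by (simp add: power_mult_distrib)
  finally show ?thesis .
qed

lemma cell_energy_nn_bound:
  assumes "\<And>x. (f x)\<^sup>2 \<le> c * cell_energy d g x" "c \<ge> 0"
  shows "(\<integral>\<^sup>+x. ennreal ((f x)\<^sup>2) \<partial>lborel) \<le> ennreal (c * d * (\<integral>t. (g t)\<^sup>2 \<partial>lborel))"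
proof -
  have [measurable]: "cell_energy d g \<in> borel_measurable borel"
  proof -
    note [measurable] = L2_measurable[OF g]
    \<comment> \<open>Written with explicit inequalities, the integrand is visibly measurable in
      \<open>x\<close> and \<open>t\<close> jointly, although the domain of integration moves with
      \<open>x\<close>.\<close>
    have "(\<lambda>x. \<integral>t. (if grid d x \<le> t \<and> t \<le> grid d x + d then 1 else 0) * (g t)\<^sup>2 \<partial>lborel) \<in> borel_measurable borel"
      by measurable
    then show ?thesis
      unfolding cell_energy_def[abs_def] indicator_def by (simp add: of_bool_def)
  qed
  have "(\<integral>\<^sup>+x. ennreal ((f x)\<^sup>2) \<partial>lborel) \<le> (\<integral>\<^sup>+x. ennreal c * ennreal (cell_energy d g x) \<partial>lborel)"
    using assms cell_energy_nonneg by (intro nn_integral_mono) (simp add: ennreal_mult[symmetric] ennreal_leI)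
  also have "\<dots> = ennreal c * ennreal (d * (\<integral>t. (g t)\<^sup>2 \<partial>lborel))"
    by (subst nn_integral_cmult) (auto simp: nn_integral_cell_energy)
  also have "\<dots> = ennreal (c * d * (\<integral>t. (g t)\<^sup>2 \<partial>lborel))"
    using assms(2) d by (simp add: ennreal_mult[symmetric] mult.assoc)
  finally show ?thesis .
qed

lemma L2_grid_slope: "L2 (grid_slope d X)" "(\<integral>x. (grid_slope d X x)\<^sup>2 \<partial>lborel) \<le> (\<integral>t. (g t)\<^sup>2 \<partial>lborel)"
proof -
  note [measurable] = antideriv_measurable[OF X]
  have m: "grid_slope d X \<in> borel_measurable borel"
    unfolding grid_slope_def[abs_def] by measurable
  have "(\<integral>\<^sup>+x. ennreal ((grid_slope d X x)\<^sup>2) \<partial>lborel) \<le> ennreal (1 / d * d * (\<integral>t. (g t)\<^sup>2 \<partial>lborel))"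
    using grid_slope_square_le d by (intro cell_energy_nn_bound) auto
  then have "(\<integral>\<^sup>+x. ennreal ((grid_slope d X x)\<^sup>2) \<partial>lborel) \<le> ennreal (\<integral>t. (g t)\<^sup>2 \<partial>lborel)"
    using d by simp
  from L2_nn_integral_bound[OF m this]
  show "L2 (grid_slope d X)" "(\<integral>x. (grid_slope d X x)\<^sup>2 \<partial>lborel) \<le> (\<integral>t. (g t)\<^sup>2 \<partial>lborel)" by auto
qed

lemma grid_interpolant_antideriv: "antideriv (grid_interpolant d X) (grid_slope d X)"
  by (intro antideriv_grid_interpolant d L2_locally_integrable L2_grid_slope)

lemma L2_grid_interpolant_error:
  "L2 (\<lambda>x. grid_interpolant d X x - X x)"
  "(\<integral>x. (grid_interpolant d X x - X x)\<^sup>2 \<partial>lborel) \<le> 4 * d\<^sup>2 * (\<integral>t. (g t)\<^sup>2 \<partial>lborel)"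
proof -
  note [measurable] = antideriv_measurable[OF X]
  have [measurable]: "grid_interpolant d X \<in> borel_measurable borel"
    using grid_interpolant_continuous[OF d] by (rule borel_measurable_continuous_onI)
  have m: "(\<lambda>x. grid_interpolant d X x - X x) \<in> borel_measurable borel" by measurable
  have "(\<integral>\<^sup>+x. ennreal ((grid_interpolant d X x - X x)\<^sup>2) \<partial>lborel) \<le> ennreal (4 * d * d * (\<integral>t. (g t)\<^sup>2 \<partial>lborel))"
    using grid_interpolant_error d by (intro cell_energy_nn_bound) auto
  from L2_nn_integral_bound[OF m this] d
  show "L2 (\<lambda>x. grid_interpolant d X x - X x)"
    "(\<integral>x. (grid_interpolant d X x - X x)\<^sup>2 \<partial>lborel) \<le> 4 * d\<^sup>2 * (\<integral>t. (g t)\<^sup>2 \<partial>lborel)"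
    by (auto simp: power2_eq_square mult.assoc)
qed

text \<open>Weaker in \<open>d\<close> than the L^2 estimate, but pointwise, as
  \<open>weak_null_antideriv\<close> requires.\<close>

lemma grid_interpolant_uniform: "(grid_interpolant d X x - X x)\<^sup>2 \<le> 4 * d * (\<integral>t. (g t)\<^sup>2 \<partial>lborel)"
  using grid_interpolant_error[of x] mult_left_mono[OF cell_energy_le[of x], of "4 * d"] d by linarith

end

section \<open>The recovery sequence\<close>

lemma periodic_continuous_bounded:
  fixes f :: "real \<Rightarrow> real"
  assumes "continuous_on UNIV f" "\<And>x. f (x + 1) = f x"
  obtains M where "M \<ge> 0" "\<And>x. \<bar>f x\<bar> \<le> M"
proof -
  have nat: "f (x + real n) = f x" for x n
    by (induction n) (use assms(2) in \<open>auto simp: algebra_simps, metis add.assoc add.commute\<close>)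
  have int: "f (x + of_int i) = f x" for x i
  proof (cases "i \<ge> 0")
    case True
    then show ?thesis using nat[of x "nat i"] by simp
  next
    case False
    then show ?thesis using nat[of "x + of_int i" "nat (- i)"] by simp
  qed
  obtain M where M: "\<forall>x\<in>{0..1}. norm (f x) \<le> M"
    using compact_imp_bounded[OF compact_continuous_image[OF continuous_on_subset[OF assms(1) subset_UNIV] compact_Icc[of 0 1]]]
    unfolding bounded_iff by auto
  have "\<bar>f x\<bar> \<le> M" for x
  proof -
    have "f x = f (frac x)" using int[of "frac x" "\<lfloor>x\<rfloor>"] by (simp add: frac_def)
    moreover have "frac x \<in> {0..1}" using frac_lt_1[of x] frac_ge_0[of x] by (auto intro: less_imp_le)
    ultimately show ?thesis using M by simp
  qed
  moreover from this[of 0] have "M \<ge> 0" by linarith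
  ultimately show ?thesis using that by blast
qed

lemma deriv_periodic:
  fixes f f' :: "real \<Rightarrow> real"
  assumes "\<And>x. (f has_real_derivative f' x) (at x)" "\<And>x. f (x + 1) = f x"
  shows "f' (x + 1) = f' x"
proof -
  have "((\<lambda>x. f (x + 1)) has_real_derivative f' (x + 1)) (at x)"
    using assms(1)[of "x + 1"] by (simp add: DERIV_shift)
  then have "(f has_real_derivative f' (x + 1)) (at x)" by (simp add: assms(2))
  then show ?thesis using assms(1) by (rule DERIV_unique)
qed

text \<open>Integers are minima of \<open>w\<close>, so \<open>w1\<close> vanishes there;
  \<open>w2\<close> is bounded by periodicity, hence \<open>|w1 z| \<le> M |z - m|\<close>. Every
  point between \<open>a\<close> and \<open>b\<close> is within \<open>|a - m| + |b - a|\<close> of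
  \<open>m\<close>, and the mean value inequality concludes. As \<open>m\<close> need not be the
  nearest integer, it can later be chosen once for each half-line.\<close>

lemma potential_increment_bound:
  fixes w w1 w2 :: "real \<Rightarrow> real"
  assumes w1: "\<And>x. (w has_real_derivative w1 x) (at x)" and w2: "\<And>x. (w1 has_real_derivative w2 x) (at x)"
    and cont: "continuous_on UNIV w2" and per: "\<And>x. w (x + 1) = w x"
    and nonneg: "\<And>x. w x \<ge> 0" and zero: "\<And>z. z \<in> \<int> \<Longrightarrow> w z = 0"
  obtains M where "M \<ge> 0" "\<And>a b m. m \<in> \<int> \<Longrightarrow> w b \<le> w a + M * \<bar>b - a\<bar> * (\<bar>a - m\<bar> + \<bar>b - a\<bar>)"
proof -
  obtain M where M: "M \<ge> 0" "\<And>x. \<bar>w2 x\<bar> \<le> M"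
    using periodic_continuous_bounded[OF cont] deriv_periodic[OF w2 deriv_periodic[OF w1 per]] by blast
  have lip: "\<bar>w1 z\<bar> \<le> M * \<bar>z - m\<bar>" if "m \<in> \<int>" for z m
  proof -
    have "w1 m = 0"
      by (rule DERIV_local_min[OF w1, of 1]) (use nonneg zero[OF that] in auto)
    moreover have "norm (w1 z - w1 m) \<le> M * norm (z - m)"
      by (rule field_differentiable_bound[of UNIV w1 w2]) (auto intro: w2 has_field_derivative_at_within simp: M)
    ultimately show ?thesis by simp
  qed
  have "w b \<le> w a + M * \<bar>b - a\<bar> * (\<bar>a - m\<bar> + \<bar>b - a\<bar>)" if m: "m \<in> \<int>" for a b m
  proof -
    have "norm (w b - w a) \<le> (M * (\<bar>a - m\<bar> + \<bar>b - a\<bar>)) * norm (b - a)"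
    proof (rule field_differentiable_bound[of "closed_segment a b" w w1])
      fix z assume "z \<in> closed_segment a b"
      then have "\<bar>z - m\<bar> \<le> \<bar>a - m\<bar> + \<bar>b - a\<bar>"
        by (auto simp: closed_segment_eq_real_ivl split: if_splits)
      then have "M * \<bar>z - m\<bar> \<le> M * (\<bar>a - m\<bar> + \<bar>b - a\<bar>)" using M(1) by (rule mult_left_mono)
      then show "norm (w1 z) \<le> M * (\<bar>a - m\<bar> + \<bar>b - a\<bar>)" using lip[OF m, of z] by simp
    qed (auto intro: w1 has_field_derivative_at_within)
    then show ?thesis by (simp add: mult_ac abs_le_iff)
  qed
  then show ?thesis using that M(1) by blast
qed

text \<open>The functions converge strongly in L^2, with an error of order \<delta>. For the slopes
  only boundedness and pointwise convergence of their primitives are used, which gives weak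
  convergence.\<close>

lemma recovery_weak_conv:
  assumes v: "antideriv v v'" "L2 v'" and X: "antideriv X g" "L2 g"
    and \<xi>: "\<xi> \<in> borel_measurable borel" "AE x in lborel. \<xi> x = X x"
      "AE x in lborel. wderiv (\<lambda>x. \<xi> x - v x) x = g x - v' x" "L2 (\<lambda>x. X x - v x)"
    and \<delta>: "\<And>n. \<delta> n > 0" "\<delta> \<longlonglongrightarrow> 0"
  shows "H1 (\<lambda>x. grid_interpolant (\<delta> n) X x - v x)"
    and "weak_conv_A v (\<lambda>n. grid_interpolant (\<delta> n) X) \<xi>"
proof -
  let ?u = "\<lambda>n. grid_interpolant (\<delta> n) X" and ?p = "\<lambda>n. grid_slope (\<delta> n) X"
  let ?D = "\<integral>t. (g t)\<^sup>2 \<partial>lborel"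
  note err = L2_grid_interpolant_error[OF X \<delta>(1)] and slope = L2_grid_slope[OF X \<delta>(1)]
  have antid: "antideriv (\<lambda>x. ?u n x - v x) (\<lambda>x. ?p n x - v' x)" for n
    by (intro antideriv_diff grid_interpolant_antideriv[OF X \<delta>(1)] v)
  have Luv: "L2 (\<lambda>x. ?u n x - v x)" for n
    using L2_add[OF err(1) \<xi>(4), of n] by simp
  have Lp: "L2 (\<lambda>x. ?p n x - v' x)" for n by (intro L2_diff slope v)
  show "H1 (\<lambda>x. ?u n x - v x)" for n
    by (rule H1I[OF antid AE_I2 L2_measurable[OF Luv] Luv Lp]) simp
  have [measurable]: "v \<in> borel_measurable borel" "v' \<in> borel_measurable borel" "X \<in> borel_measurable borel"
    "g \<in> borel_measurable borel" "?p n \<in> borel_measurable borel" for n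
    using antideriv_continuous[OF v(1)] antideriv_continuous[OF X(1)] L2_measurable[OF v(2)]
      L2_measurable[OF X(2)] L2_measurable[OF slope(1)]
    by (auto intro: borel_measurable_continuous_onI)
  note [measurable] = \<xi>(1)
  have aeX: "AE x in lborel. \<xi> x - v x = X x - v x" using \<xi>(2) by eventually_elim simp
  have aXv: "antideriv (\<lambda>x. X x - v x) (\<lambda>x. g x - v' x)" by (intro antideriv_diff X v)
  have wf: "wderiv (\<lambda>x. \<xi> x - v x) \<in> borel_measurable borel"
    by (rule wderiv_antideriv(3)[OF aXv aeX]) measurable
  note [measurable] = wf
  show "weak_conv_A v ?u \<xi>"
    unfolding weak_conv_A_def
  proof (intro allI impI)
    fix G assume "H1 G"
    then obtain L: "L2 (wderiv G)" "L2 G" by (rule H1E)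
    note [measurable] = L2_measurable[OF L(1)] L2_measurable[OF L(2)]
    have lim1: "(\<lambda>n. \<integral>x. (?u n x - X x) * G x \<partial>lborel) \<longlonglongrightarrow> 0"
    proof (rule Lim_null_comparison)
      show "\<forall>\<^sub>F n in sequentially. norm (\<integral>x. (?u n x - X x) * G x \<partial>lborel) \<le> sqrt (4 * (\<delta> n)\<^sup>2 * ?D * (\<integral>x. (G x)\<^sup>2 \<partial>lborel))"
        using Cauchy_Schwarz_L2_sqrt[OF err(1) L(2) err(2)] by simp
      have "(\<lambda>n. sqrt (4 * (\<delta> n)\<^sup>2 * ?D * (\<integral>x. (G x)\<^sup>2 \<partial>lborel))) \<longlonglongrightarrow> sqrt (4 * 0\<^sup>2 * ?D * (\<integral>x. (G x)\<^sup>2 \<partial>lborel))"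
        by (intro tendsto_intros \<delta>)
      then show "(\<lambda>n. sqrt (4 * (\<delta> n)\<^sup>2 * ?D * (\<integral>x. (G x)\<^sup>2 \<partial>lborel))) \<longlonglongrightarrow> 0" by simp
    qed
    have lim2: "(\<lambda>n. \<integral>x. (?p n x - g x) * wderiv G x \<partial>lborel) \<longlonglongrightarrow> 0"
    \<comment> \<open>By \<open>L2_diff_square_le\<close> the bound is \<open>2 ?D + 2 ?D\<close>,
      since the slopes have no more energy than \<open>g\<close>.\<close>
    proof (rule weak_null_antideriv[where F = "\<lambda>n x. ?u n x - X x" and C = "4 * ?D"])
      show "antideriv (\<lambda>x. ?u n x - X x) (\<lambda>x. ?p n x - g x)" for n
        by (intro antideriv_diff grid_interpolant_antideriv[OF X \<delta>(1)] X)
      show "L2 (\<lambda>x. ?p n x - g x)" for n by (intro L2_diff slope X)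
      show "(\<integral>x. (?p n x - g x)\<^sup>2 \<partial>lborel) \<le> 4 * ?D" for n
        using L2_diff_square_le[OF slope(1) X(2), of n] slope(2)[of n] by linarith
      fix x
      show "(\<lambda>n. ?u n x - X x) \<longlonglongrightarrow> 0"
      proof (rule Lim_null_comparison)
        have "\<bar>?u n x - X x\<bar> \<le> sqrt (4 * \<delta> n * ?D)" for n
          using grid_interpolant_uniform[OF X \<delta>(1), of n x] by (intro real_le_rsqrt) simp
        then show "\<forall>\<^sub>F n in sequentially. norm (?u n x - X x) \<le> sqrt (4 * \<delta> n * ?D)" by simp
        have "(\<lambda>n. sqrt (4 * \<delta> n * ?D)) \<longlonglongrightarrow> sqrt (4 * 0 * ?D)" by (intro tendsto_intros \<delta>)
        then show "(\<lambda>n. sqrt (4 * \<delta> n * ?D)) \<longlonglongrightarrow> 0" by simp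
      qed
    qed (rule L)
    \<comment> \<open>After passing to representatives and to computed weak derivatives, the inner
      product splits into its limit plus the two vanishing pairings.\<close>
    have eq: "H1_inner (\<lambda>x. ?u n x - v x) G = H1_inner (\<lambda>x. \<xi> x - v x) G
      + ((\<integral>x. (?u n x - X x) * G x \<partial>lborel) + (\<integral>x. (?p n x - g x) * wderiv G x \<partial>lborel))" for n
    proof -
      have [measurable]: "?u n \<in> borel_measurable borel"
        using grid_interpolant_continuous[OF \<delta>(1)] by (rule borel_measurable_continuous_onI)
      have w: "AE x in lborel. wderiv (\<lambda>x. ?u n x - v x) x = ?p n x - v' x"
        and [measurable]: "wderiv (\<lambda>x. ?u n x - v x) \<in> borel_measurable borel"
        using wderiv_antideriv(2,3)[OF antid AE_I2 L2_measurable[OF Luv], of n] by auto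
      have "(\<integral>x. (\<xi> x - v x) * G x \<partial>lborel) = (\<integral>x. (X x - v x) * G x \<partial>lborel)"
        by (rule integral_cong_AE) (use \<xi>(2) in \<open>auto elim!: eventually_mono\<close>)
      moreover have "(\<integral>x. wderiv (\<lambda>x. \<xi> x - v x) x * wderiv G x \<partial>lborel) = (\<integral>x. (g x - v' x) * wderiv G x \<partial>lborel)"
        by (rule integral_cong_AE) (use \<xi>(3) in \<open>auto elim!: eventually_mono\<close>)
      moreover have "(\<integral>x. wderiv (\<lambda>x. ?u n x - v x) x * wderiv G x \<partial>lborel) = (\<integral>x. (?p n x - v' x) * wderiv G x \<partial>lborel)"
        by (rule integral_cong_AE) (use w in \<open>auto elim!: eventually_mono\<close>)
      moreover have "(\<integral>x. (?u n x - v x) * G x \<partial>lborel) = (\<integral>x. (X x - v x) * G x + (?u n x - X x) * G x \<partial>lborel)"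
        by (intro Bochner_Integration.integral_cong) (auto simp: algebra_simps)
      moreover have "\<dots> = (\<integral>x. (X x - v x) * G x \<partial>lborel) + (\<integral>x. (?u n x - X x) * G x \<partial>lborel)"
        by (intro Bochner_Integration.integral_add L2_mult_integrable L \<xi> err)
      moreover have "(\<integral>x. (?p n x - v' x) * wderiv G x \<partial>lborel) = (\<integral>x. (g x - v' x) * wderiv G x + (?p n x - g x) * wderiv G x \<partial>lborel)"
        by (intro Bochner_Integration.integral_cong) (auto simp: algebra_simps)
      moreover have "\<dots> = (\<integral>x. (g x - v' x) * wderiv G x \<partial>lborel) + (\<integral>x. (?p n x - g x) * wderiv G x \<partial>lborel)"
        by (intro Bochner_Integration.integral_add L2_mult_integrable L2_diff L slope X v)
      ultimately show ?thesis unfolding H1_inner_def by simp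
    qed
    show "(\<lambda>n. H1_inner (\<lambda>x. ?u n x - v x) G) \<longlonglongrightarrow> H1_inner (\<lambda>x. \<xi> x - v x) G"
      unfolding eq using tendsto_add[OF tendsto_const tendsto_add[OF lim1 lim2], of "H1_inner (\<lambda>x. \<xi> x - v x) G"] by simp
  qed
qed

lemma recovery_limsup:
  assumes X: "antideriv X g" "L2 g" and Xm: "L2 (\<lambda>x. X x - m x)" "\<And>x. m x \<in> \<int>"
    and \<delta>: "\<And>n. \<delta> n > 0" "\<delta> \<longlonglongrightarrow> 0"
    and w: "\<And>x. w x \<ge> 0" "continuous_on UNIV w" 
    and M: "M \<ge> 0" "\<And>a b m. m \<in> \<int> \<Longrightarrow> w b \<le> w a + M * \<bar>b - a\<bar> * (\<bar>a - m\<bar> + \<bar>b - a\<bar>)"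
  shows "limsup (\<lambda>n. Fen w (grid_interpolant (\<delta> n) X))
    \<le> (\<integral>\<^sup>+x. ennreal ((g x)\<^sup>2) \<partial>lborel) + (\<integral>\<^sup>+x. ennreal (w (X x)) \<partial>lborel)"
proof -
  let ?u = "\<lambda>n. grid_interpolant (\<delta> n) X" and ?p = "\<lambda>n. grid_slope (\<delta> n) X"
  let ?D = "\<integral>t. (g t)\<^sup>2 \<partial>lborel" and ?E = "\<integral>x. \<bar>X x - m x\<bar>\<^sup>2 \<partial>lborel"
  let ?R = "(\<integral>\<^sup>+x. ennreal ((g x)\<^sup>2) \<partial>lborel) + (\<integral>\<^sup>+x. ennreal (w (X x)) \<partial>lborel)"
  \<comment> \<open>With \<open>e = |u - X|\<close>, the root bounds the integral of
    \<open>e |X - m|\<close> by Cauchy-Schwarz and the last term bounds the integral of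
    \<open>e^2\<close>; \<open>M\<close> comes from the increment bound on \<open>w\<close>.\<close>
  define \<epsilon> where "\<epsilon> n = M * (sqrt (4 * (\<delta> n)\<^sup>2 * ?D * ?E) + 4 * (\<delta> n)\<^sup>2 * ?D)" for n
  note err = L2_grid_interpolant_error[OF X \<delta>(1)] and slope = L2_grid_slope[OF X \<delta>(1)]
  have [measurable]: "X \<in> borel_measurable borel" "w \<in> borel_measurable borel" "?u n \<in> borel_measurable borel" for n
    using antideriv_continuous[OF X(1)] w(2) grid_interpolant_continuous[OF \<delta>(1)]
    by (auto intro: borel_measurable_continuous_onI)
  have "Fen w (?u n) \<le> ?R + ennreal (\<epsilon> n)" for n
  proof -
    have antid: "antideriv (?u n) (?p n)" by (rule grid_interpolant_antideriv[OF X \<delta>(1)])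
    have "Fen w (?u n) = (\<integral>\<^sup>+x. ennreal ((?p n x)\<^sup>2) \<partial>lborel) + (\<integral>\<^sup>+x. ennreal (w (?u n x)) \<partial>lborel)"
      by (rule Fen_repr[OF AE_I2 wderiv_antideriv(2)[OF antid AE_I2]]) auto
    also have "(\<integral>\<^sup>+x. ennreal ((?p n x)\<^sup>2) \<partial>lborel) \<le> (\<integral>\<^sup>+x. ennreal ((g x)\<^sup>2) \<partial>lborel)"
      using slope(2)[of n] nn_integral_eq_integral[OF L2_square_integrable[OF slope(1)], of n]
        nn_integral_eq_integral[OF L2_square_integrable[OF X(2)]]
      by (simp add: ennreal_leI)
    also have "(\<integral>\<^sup>+x. ennreal (w (?u n x)) \<partial>lborel) \<le> (\<integral>\<^sup>+x. ennreal (w (X x)) \<partial>lborel) + ennreal (\<epsilon> n)"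
    proof -
      define e where "e x = \<bar>?u n x - X x\<bar>" for x
      define r where "r x = M * (e x * \<bar>X x - m x\<bar> + (e x)\<^sup>2)" for x
      have Le: "L2 e" "L2 (\<lambda>x. \<bar>X x - m x\<bar>)"
        unfolding e_def using err(1) Xm(1) by (auto simp: L2_def)
      have ie: "integrable lborel (\<lambda>x. e x * \<bar>X x - m x\<bar>)" "integrable lborel (\<lambda>x. (e x)\<^sup>2)"
        using L2_mult_integrable[OF Le] L2_square_integrable[OF Le(1)] by auto
      have ir: "integrable lborel r" unfolding r_def using ie by simp
      have r0: "r x \<ge> 0" for x unfolding r_def e_def using M(1) by simp
      have le: "(\<integral>x. (e x)\<^sup>2 \<partial>lborel) \<le> 4 * (\<delta> n)\<^sup>2 * ?D" unfolding e_def using err(2)[of n] by simp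
      have "(\<integral>x. r x \<partial>lborel) = M * ((\<integral>x. e x * \<bar>X x - m x\<bar> \<partial>lborel) + (\<integral>x. (e x)\<^sup>2 \<partial>lborel))"
        unfolding r_def using ie by simp
      also have "\<dots> \<le> \<epsilon> n"
        unfolding \<epsilon>_def using Cauchy_Schwarz_L2_sqrt[OF Le le] le M(1)
        by (intro mult_left_mono add_mono) auto
      finally have r\<epsilon>: "(\<integral>x. r x \<partial>lborel) \<le> \<epsilon> n" .
      have "(\<integral>\<^sup>+x. ennreal (w (?u n x)) \<partial>lborel) \<le> (\<integral>\<^sup>+x. ennreal (w (X x)) + ennreal (r x) \<partial>lborel)"
      proof (rule nn_integral_mono)
        fix x
        have "w (?u n x) \<le> w (X x) + r x"
          using M(2)[OF Xm(2), of "?u n x" "X x" x] by (simp add: r_def e_def power2_eq_square algebra_simps)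
        then show "ennreal (w (?u n x)) \<le> ennreal (w (X x)) + ennreal (r x)"
          using w(1) r0 by (simp add: ennreal_plus[symmetric] ennreal_leI del: ennreal_plus)
      qed
      also have "\<dots> = (\<integral>\<^sup>+x. ennreal (w (X x)) \<partial>lborel) + (\<integral>\<^sup>+x. ennreal (r x) \<partial>lborel)"
        using borel_measurable_integrable[OF ir] by (intro nn_integral_add) auto
      also have "(\<integral>\<^sup>+x. ennreal (r x) \<partial>lborel) \<le> ennreal (\<epsilon> n)"
        using nn_integral_eq_integral[OF ir] r0 r\<epsilon> by (simp add: ennreal_leI)
      finally show ?thesis by (simp add: add_left_mono)
    qed
    finally show ?thesis by (simp add: add.assoc add_mono)
  qed
  then have "limsup (\<lambda>n. Fen w (?u n)) \<le> limsup (\<lambda>n. ?R + ennreal (\<epsilon> n))"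
    by (intro Limsup_mono) simp
  also have "\<dots> = ?R"
  proof (rule lim_imp_Limsup)
    have "\<epsilon> \<longlonglongrightarrow> M * (sqrt (4 * 0\<^sup>2 * ?D * ?E) + 4 * 0\<^sup>2 * ?D)"
      unfolding \<epsilon>_def by (intro tendsto_intros \<delta>)
    then have "(\<lambda>n. ennreal (\<epsilon> n)) \<longlonglongrightarrow> ennreal 0" by (intro tendsto_ennrealI) simp
    from tendsto_add[OF tendsto_const this, of ?R] show "(\<lambda>n. ?R + ennreal (\<epsilon> n)) \<longlonglongrightarrow> ?R" by simp
  qed simp
  finally show ?thesis .
qed

section \<open>The two inequalities of the \<Gamma>-limit\<close>

theorem theorem3p3:
  fixes w w1 w2 w3 vbar vbar' :: "real \<Rightarrow> real" and \<delta> :: "nat \<Rightarrow> real"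
  assumes w1: "\<And>x. (w has_real_derivative w1 x) (at x)"
      and w2: "\<And>x. (w1 has_real_derivative w2 x) (at x)"
      and w3: "\<And>x. (w2 has_real_derivative w3 x) (at x)"
      and w3_cont: "continuous_on UNIV w3"
      and w_per: "\<And>x. w (x + 1) = w x"
      and w_int: "\<And>z. z \<in> \<int> \<Longrightarrow> w z = 0"
      and w_pos: "\<And>x. x \<notin> \<int> \<Longrightarrow> w x > 0"
      and w2_pos: "\<And>z. z \<in> \<int> \<Longrightarrow> w2 z > 0"
      and w_sym: "\<And>x. w (1 - x) = w x"
      and v_deriv: "\<And>x. (vbar has_real_derivative vbar' x) (at x)"
      and v_cont: "continuous_on UNIV vbar'"
      and v_mono: "strict_mono vbar"
      and v_bot: "(vbar \<longlongrightarrow> 0) at_bot"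
      and v_top: "(vbar \<longlongrightarrow> 1) at_top"
      and v_L1_pos: "set_integrable lborel {0..} (\<lambda>x. 1 - vbar x)"
      and v_L2_pos: "set_integrable lborel {0..} (\<lambda>x. (1 - vbar x)\<^sup>2)"
      and v_L1_neg: "set_integrable lborel {..0} vbar"
      and v_L2_neg: "set_integrable lborel {..0} (\<lambda>x. (vbar x)\<^sup>2)"
      and v'_L1: "integrable lborel vbar'"
      and v'_L2: "integrable lborel (\<lambda>x. (vbar' x)\<^sup>2)"
      and d_pos: "\<And>n. \<delta> n > 0"
      and d_lim: "\<delta> \<longlonglongrightarrow> 0"
  shows "(\<forall>\<xi>s \<in> adm vbar. \<forall>xs. (\<forall>n. xs n \<in> adm vbar) \<and> weak_conv_A vbar xs \<xi>s \<longrightarrow>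
            liminf (\<lambda>n. Eden w vbar (\<delta> n) (xs n)) \<ge> Fen w \<xi>s)
       \<and> (\<forall>\<xi>s \<in> adm vbar. \<exists>xs. (\<forall>n. xs n \<in> adm vbar) \<and> weak_conv_A vbar xs \<xi>s \<and>
            limsup (\<lambda>n. Eden w vbar (\<delta> n) (xs n)) \<le> Fen w \<xi>s)"
proof (intro conjI ballI allI impI)
  have av: "antideriv vbar vbar'" using v_deriv v_cont by (rule antideriv_C1)
  have Lv: "L2 vbar'"
    using v'_L2 v_cont unfolding L2_def by (auto intro: borel_measurable_continuous_onI)
  have w_cont: "continuous_on UNIV w" "continuous_on UNIV w2"
    by (rule DERIV_continuous_on, rule w1 w3)+
  have w_nonneg: "w x \<ge> 0" for x
    using w_int[of x] w_pos[of x] by (cases "x \<in> \<int>") auto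
  show "Fen w \<xi>s \<le> liminf (\<lambda>n. Eden w vbar (\<delta> n) (xs n))"
    if \<xi>s: "\<xi>s \<in> adm vbar" and xs: "(\<forall>n. xs n \<in> adm vbar) \<and> weak_conv_A vbar xs \<xi>s" for \<xi>s xs
  proof -
    have "Fen w \<xi>s \<le> liminf (\<lambda>n. Fen w (xs n))"
      using xs by (intro Fen_lower_semicontinuous[OF av Lv w_cont(1) \<xi>s]) auto
    also have "\<dots> \<le> liminf (\<lambda>n. Eden w vbar (\<delta> n) (xs n))"
      by (intro Liminf_mono always_eventually allI Fen_le_Eden)
    finally show ?thesis .
  qed
  show "\<exists>xs. (\<forall>n. xs n \<in> adm vbar) \<and> weak_conv_A vbar xs \<xi>s \<and>
      limsup (\<lambda>n. Eden w vbar (\<delta> n) (xs n)) \<le> Fen w \<xi>s"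
    if \<xi>s: "\<xi>s \<in> adm vbar" for \<xi>s
  proof (rule adm_repr[OF \<xi>s av Lv])
    fix X g
    assume X: "antideriv X g" "L2 g" "AE x in lborel. \<xi>s x = X x" "AE x in lborel. wderiv \<xi>s x = g x"
      "AE x in lborel. wderiv (\<lambda>x. \<xi>s x - vbar x) x = g x - vbar' x" "L2 (\<lambda>x. X x - vbar x)"
      "\<xi>s \<in> borel_measurable borel"
    let ?u = "\<lambda>n. grid_interpolant (\<delta> n) X"
    note rec = recovery_weak_conv[OF av Lv X(1,2,7,3,5,6) d_pos d_lim]
    have adm: "?u n \<in> adm vbar" for n using rec(1) unfolding adm_def by simp
    have adm_d: "?u n \<in> adm_delta vbar (\<delta> n)" for n
    proof -
      have "\<exists>a b. \<forall>x\<in>{(of_int i - 1) * \<delta> n..of_int i * \<delta> n}. ?u n x = a * x + b" for i :: int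
      proof -
        define s where "s = (X (of_int i * \<delta> n) - X ((of_int i - 1) * \<delta> n)) / \<delta> n"
        have "?u n x = s * x + (X ((of_int i - 1) * \<delta> n) - s * ((of_int i - 1) * \<delta> n))"
          if "x \<in> {(of_int i - 1) * \<delta> n..of_int i * \<delta> n}" for x
        proof -
          have "?u n x = X ((of_int i - 1) * \<delta> n) + (x - (of_int i - 1) * \<delta> n) * s"
            \<comment> \<open>Cells of \<open>adm_delta\<close> are indexed by their right node,
              those of the interpolant by their left one; hence \<open>i - 1\<close>.\<close>
            using grid_interpolant_affine[OF d_pos, of x "i - 1" n X] that by (simp add: s_def)
          then show ?thesis by (simp add: algebra_simps)
        qed
        then show ?thesis by blast
      qed
      then show ?thesis
        unfolding adm_delta_def using adm grid_interpolant_continuous[OF d_pos] by blast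
    qed
    \<comment> \<open>The integers towards which \<open>vbar\<close> tends on the two half-lines.
      The hypotheses on \<open>vbar\<close> put \<open>vbar - m\<close> in L^2, and admissibility
      then puts \<open>X - m\<close> there.\<close>
    define m where "m x = (if x \<le> 0 then 0 else 1 :: real)" for x :: real
    have "L2 (\<lambda>x. vbar x - m x)"
    proof -
      have [measurable]: "vbar \<in> borel_measurable borel"
        by (rule antideriv_measurable[OF av])
      \<comment> \<open>Both half-lines contain 0; the overlap is harmless because this function
        only serves as an upper bound.\<close>
      have "integrable lborel (\<lambda>x. indicator {0..} x * (1 - vbar x)\<^sup>2 + indicator {..0} x * (vbar x)\<^sup>2)"
        using v_L2_pos v_L2_neg unfolding set_integrable_def by simp
      then have "integrable lborel (\<lambda>x. (vbar x - m x)\<^sup>2)"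
        by (rule Bochner_Integration.integrable_bound)
          (auto simp: m_def indicator_def power2_commute)
      moreover have "(\<lambda>x. vbar x - m x) \<in> borel_measurable lborel" unfolding m_def by measurable
      ultimately show ?thesis unfolding L2_def by blast
    qed
    from L2_add[OF X(6) this] have Xm: "L2 (\<lambda>x. X x - m x)" by simp
    obtain M where M: "M \<ge> 0" "\<And>a b m. m \<in> \<int> \<Longrightarrow> w b \<le> w a + M * \<bar>b - a\<bar> * (\<bar>a - m\<bar> + \<bar>b - a\<bar>)"
      using potential_increment_bound[OF w1 w2 w_cont(2) w_per w_nonneg w_int] by blast
    have "limsup (\<lambda>n. Eden w vbar (\<delta> n) (?u n)) = limsup (\<lambda>n. Fen w (?u n))"
      using adm_d by (simp add: Eden_def)
    also have "\<dots> \<le> Fen w \<xi>s"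
      unfolding Fen_repr[OF X(3,4)]
      by (rule recovery_limsup[OF X(1,2) Xm _ d_pos d_lim w_nonneg w_cont(1) M]) (auto simp: m_def)
    finally have "limsup (\<lambda>n. Eden w vbar (\<delta> n) (?u n)) \<le> Fen w \<xi>s" .
    then show ?thesis using adm rec(2) by (intro exI[of _ ?u]) simp
  qed
qed

end
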